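(* Let $\mathcal{U}$ be a $\lambda$-ultrafilter on the probability space $([0,1),\mathcal{B}([0,1)),\lambda)$, $\lambda$ Lebesgue measure. Then the $P$-operator $A\colon L^\infty(\lambda)\to L^1(\lambda)$ given by $Af=\left(\int f\,d\delta_\mathcal{U}\right)\cdot\chi_{[0,1)}$ satisfies $\lim_{n\to\infty}d_M(S_n,A)=0$, where $S_n$ is the star on $n$ vertices.
   Context: A $P$-operator is a linear operator $A\colon L^\infty(\Omega)\to L^1(\Omega)$ on a probability space with $\|A\|_{\infty\to1}<\infty$. For $k\ge1$, $\mathcal{S}_k(A)=\{\mathcal{D}(f_1,\dots,f_k,Af_1,\dots,Af_k):f_i\in B_1^{L^\infty}\}\subset\mathcal{P}(\mathbb{R}^{2k})$ (joint distributions; $B_1^{L^\infty}$ the closed unit ball of $L^\infty$). $d_M(A,B)=\sum_{k\ge1}2^{-k}d_H(\mathcal{S}_k(A),\mathcal{S}_k(B))$, with $d_H$ the Hausdorff distance induced by the Lévy–Prokhorov metric on $\mathcal{P}(\mathbb{R}^{2k})$. $S_n$ is the $n$-vertex tree with $n-1$ leaves, identified with its adjacency operator on the uniform probability space on its vertex set, $(S_nv)(x)=\sum_{y\sim x}v(y)$. A $\lambda$-ultrafilter is a maximal collection $\mathcal{U}$ of measurable sets of positive measure closed under finite intersections and measurable supersets; $\delta_\mathcal{U}(E)=1$ if $E\in\mathcal{U}$, $0$ otherwise, and $\int f\,d\delta_\mathcal{U}=\lim_n\sum_i\alpha_{n,i}\delta_\mathcal{U}(E_{n,i})$ for simple functions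 $\sum_i\alpha_{n,i}\chi_{E_{n,i}}\to f$ in $L^\infty$. *)

theory Defs
  imports "HOL-Probability.Probability"
begin

section \<open>P-operators\<close>

text \<open>
  Elements of \<open>L\<^sup>\<infinity>\<close> and \<open>L\<^sup>1\<close> are represented by real functions, and an operator acts
  on representatives; compatibility with almost-everywhere equality is part of \<open>P_operator\<close>.
\<close>

definition Linf_norm :: "'a measure \<Rightarrow> ('a \<Rightarrow> real) \<Rightarrow> ereal" where
  "Linf_norm M f = esssup M (\<lambda>x. ereal \<bar>f x\<bar>)"

definition Linf :: "'a measure \<Rightarrow> ('a \<Rightarrow> real) set" where
  "Linf M = {f \<in> borel_measurable M. Linf_norm M f < \<infinity>}"

definition Linf_ball :: "'a measure \<Rightarrow> ('a \<Rightarrow> real) set" where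
  "Linf_ball M = {f \<in> Linf M. Linf_norm M f \<le> 1}"

definition norm_inf_1 :: "'a measure \<Rightarrow> (('a \<Rightarrow> real) \<Rightarrow> 'a \<Rightarrow> real) \<Rightarrow> ennreal" where
  "norm_inf_1 M A = (SUP f\<in>Linf_ball M. \<integral>\<^sup>+x. ennreal \<bar>A f x\<bar> \<partial>M)"

definition P_operator :: "'a measure \<Rightarrow> (('a \<Rightarrow> real) \<Rightarrow> 'a \<Rightarrow> real) \<Rightarrow> bool" where
  "P_operator M A \<longleftrightarrow>
     prob_space M \<and>
     (\<forall>f\<in>Linf M. integrable M (A f)) \<and>
     (\<forall>f\<in>Linf M. \<forall>g\<in>Linf M. (AE x in M. f x = g x) \<longrightarrow> (AE x in M. A f x = A g x)) \<and>
     (\<forall>f\<in>Linf M. \<forall>g\<in>Linf M. \<forall>a b.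
        AE x in M. A (\<lambda>y. a * f y + b * g y) x = a * A f x + b * A g x) \<and>
     norm_inf_1 M A < \<infinity>"

section \<open>The metric on P-operators\<close>

text \<open>\<open>\<real>\<^sup>d\<close> is the set of extensional functions on \<open>{..<d}\<close>, with its Borel sets and the
  Euclidean distance.\<close>

definition Rn :: "nat \<Rightarrow> (nat \<Rightarrow> real) measure" where
  "Rn d = (\<Pi>\<^sub>M i\<in>{..<d}. borel)"

definition Rn_dist :: "nat \<Rightarrow> (nat \<Rightarrow> real) \<Rightarrow> (nat \<Rightarrow> real) \<Rightarrow> real" where
  "Rn_dist d x y = L2_set (\<lambda>i. x i - y i) {..<d}"

definition Rn_nbhd :: "nat \<Rightarrow> real \<Rightarrow> (nat \<Rightarrow> real) set \<Rightarrow> (nat \<Rightarrow> real) set" where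
  "Rn_nbhd d e B = {y \<in> space (Rn d). \<exists>x\<in>B. Rn_dist d x y < e}"

definition LP_dist :: "nat \<Rightarrow> (nat \<Rightarrow> real) measure \<Rightarrow> (nat \<Rightarrow> real) measure \<Rightarrow> real" where
  "LP_dist d \<mu> \<nu> = Inf {e. 0 < e \<and>
     (\<forall>B\<in>sets (Rn d). measure \<mu> B \<le> measure \<nu> (Rn_nbhd d e B) + e \<and>
                       measure \<nu> B \<le> measure \<mu> (Rn_nbhd d e B) + e)}"

definition hausdorff_distance :: "('a \<Rightarrow> 'a \<Rightarrow> real) \<Rightarrow> 'a set \<Rightarrow> 'a set \<Rightarrow> real" where
  "hausdorff_distance d X Y =
     max (SUP x\<in>X. INF y\<in>Y. d x y) (SUP y\<in>Y. INF x\<in>X. d x y)"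

definition joint_distr ::
  "'a measure \<Rightarrow> (('a \<Rightarrow> real) \<Rightarrow> 'a \<Rightarrow> real) \<Rightarrow> nat \<Rightarrow> (nat \<Rightarrow> 'a \<Rightarrow> real) \<Rightarrow> (nat \<Rightarrow> real) measure"
where
  "joint_distr M A k f =
     distr M (Rn (2 * k)) (\<lambda>x. \<lambda>i\<in>{..<2 * k}. if i < k then f i x else A (f (i - k)) x)"

definition k_profile ::
  "'a measure \<Rightarrow> (('a \<Rightarrow> real) \<Rightarrow> 'a \<Rightarrow> real) \<Rightarrow> nat \<Rightarrow> (nat \<Rightarrow> real) measure set"
where
  "k_profile M A k = {joint_distr M A k f | f. \<forall>i<k. f i \<in> Linf_ball M}"

text \<open>The sum starts at \<open>k = 1\<close>, hence the shift by \<open>Suc\<close>.\<close>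

definition d_M ::
  "'a measure \<Rightarrow> (('a \<Rightarrow> real) \<Rightarrow> 'a \<Rightarrow> real) \<Rightarrow>
   'b measure \<Rightarrow> (('b \<Rightarrow> real) \<Rightarrow> 'b \<Rightarrow> real) \<Rightarrow> real"
where
  "d_M M A N B = (\<Sum>k. (1 / 2) ^ Suc k *
     hausdorff_distance (LP_dist (2 * Suc k)) (k_profile M A (Suc k)) (k_profile N B (Suc k)))"

section \<open>Stars and adjacency operators\<close>

definition simple_graph :: "'v set \<Rightarrow> ('v \<Rightarrow> 'v \<Rightarrow> bool) \<Rightarrow> bool" where
  "simple_graph V adj \<longleftrightarrow> finite V \<and>
     (\<forall>x y. adj x y \<longrightarrow> x \<in> V \<and> y \<in> V \<and> x \<noteq> y \<and> adj y x)"

definition graph_connected :: "'v set \<Rightarrow> ('v \<Rightarrow> 'v \<Rightarrow> bool) \<Rightarrow> bool" where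
  "graph_connected V adj \<longleftrightarrow> V \<noteq> {} \<and> (\<forall>x\<in>V. \<forall>y\<in>V. adj\<^sup>*\<^sup>* x y)"

definition graph_cycle :: "('v \<Rightarrow> 'v \<Rightarrow> bool) \<Rightarrow> 'v list \<Rightarrow> bool" where
  "graph_cycle adj p \<longleftrightarrow>
     3 \<le> length p \<and> distinct p \<and> successively adj p \<and> adj (last p) (hd p)"

definition graph_tree :: "'v set \<Rightarrow> ('v \<Rightarrow> 'v \<Rightarrow> bool) \<Rightarrow> bool" where
  "graph_tree V adj \<longleftrightarrow>
     simple_graph V adj \<and> graph_connected V adj \<and> (\<nexists>p. graph_cycle adj p)"

definition graph_leaves :: "'v set \<Rightarrow> ('v \<Rightarrow> 'v \<Rightarrow> bool) \<Rightarrow> 'v set" where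
  "graph_leaves V adj = {x \<in> V. card {y \<in> V. adj x y} = 1}"

definition star_graph :: "nat \<Rightarrow> 'v set \<Rightarrow> ('v \<Rightarrow> 'v \<Rightarrow> bool) \<Rightarrow> bool" where
  "star_graph n V adj \<longleftrightarrow>
     graph_tree V adj \<and> card V = n \<and> card (graph_leaves V adj) = n - 1"

definition adjacency_operator ::
  "'v set \<Rightarrow> ('v \<Rightarrow> 'v \<Rightarrow> bool) \<Rightarrow> ('v \<Rightarrow> real) \<Rightarrow> 'v \<Rightarrow> real"
where
  "adjacency_operator V adj v x = (\<Sum>y\<in>{y \<in> V. adj x y}. v y)"

lemma star_graph_exists:
  assumes "3 \<le> n"
  shows "star_graph n {..<n} (\<lambda>x y. x < n \<and> y < n \<and> x \<noteq> y \<and> (x = 0 \<or> y = 0))"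
    (is "star_graph n ?V ?adj")
proof -
  have conn: "?adj\<^sup>*\<^sup>* x y" if "x < n" "y < n" for x y
  proof -
    have "?adj\<^sup>*\<^sup>* x 0" using that by (cases "x = 0") auto
    moreover have "?adj\<^sup>*\<^sup>* 0 y" using that by (cases "y = 0") auto
    ultimately show ?thesis by (rule rtranclp_trans)
  qed
  have acyc: "\<not> graph_cycle ?adj p" for p
  proof
    assume p: "graph_cycle ?adj p"
    then obtain a b c q where "p = a # b # c # q"
      by (auto simp: graph_cycle_def numeral_3_eq_3 Suc_le_length_iff)
    with p show False
      by (cases q) (auto simp: graph_cycle_def split: if_splits)
  qed
  have nb0: "{y \<in> ?V. ?adj 0 y} = {1..<n}" using assms by auto
  have nb: "{y \<in> ?V. ?adj x y} = {0}" if "x < n" "x \<noteq> 0" for x using that by auto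
  have deg: "card {y \<in> ?V. ?adj x y} = 1 \<longleftrightarrow> x \<noteq> 0" if "x < n" for x
  proof (cases "x = 0")
    case True
    with nb0 have "card {y \<in> ?V. ?adj x y} = card {1..<n}" by simp
    with True assms show ?thesis by simp
  next
    case False
    have "card {y \<in> ?V. ?adj x y} = card {0::nat}" unfolding nb[OF that False] ..
    with False show ?thesis by simp
  qed
  have "graph_leaves ?V ?adj = {x \<in> ?V. x \<noteq> 0}"
    unfolding graph_leaves_def by (intro Collect_cong conj_cong refl deg) simp
  also have "\<dots> = {1..<n}" by auto
  finally have "card (graph_leaves ?V ?adj) = n - 1" by simp
  moreover have "graph_tree ?V ?adj"
    unfolding graph_tree_def graph_connected_def simple_graph_def
    using conn acyc assms by (auto simp: lessThan_empty_iff)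
  ultimately show ?thesis by (simp add: star_graph_def)
qed

lemma P_operator_adjacency_operator:
  assumes "finite V" "V \<noteq> {}"
  shows "P_operator (uniform_count_measure V) (adjacency_operator V adj)"
proof -
  let ?M = "uniform_count_measure V"
  interpret prob_space ?M using assms by (rule prob_space_uniform_count_measure)
  have AE: "(AE x in ?M. P x) \<longleftrightarrow> (\<forall>x\<in>V. P x)" for P
    using assms unfolding uniform_count_measure_def
    by (subst AE_point_measure) (auto simp: card_gt_0_iff)
  have int: "integrable ?M g" for g :: "'a \<Rightarrow> real"
    unfolding uniform_count_measure_def using assms by (intro integrable_point_measure_finite)
  have bd: "\<bar>adjacency_operator V adj f x\<bar> \<le> real (card V)" if "f \<in> Linf_ball ?M" for f x
  proof -
    have "AE y in ?M. ereal \<bar>f y\<bar> \<le> Linf_norm ?M f"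
      unfolding Linf_norm_def by (rule esssup_AE)
    moreover have "Linf_norm ?M f \<le> 1" using that by (simp add: Linf_ball_def)
    ultimately have b: "\<bar>f y\<bar> \<le> 1" if "y \<in> V" for y
      using that unfolding AE by (metis ereal_less_eq(3) one_ereal_def order_trans)
    have "\<bar>adjacency_operator V adj f x\<bar> \<le> (\<Sum>y\<in>{y \<in> V. adj x y}. \<bar>f y\<bar>)"
      unfolding adjacency_operator_def by (rule sum_abs)
    also have "\<dots> \<le> (\<Sum>y\<in>{y \<in> V. adj x y}. 1)" by (rule sum_mono) (use b in auto)
    also have "\<dots> \<le> real (card V)" using assms by (auto intro: card_mono)
    finally show ?thesis .
  qed
  have "norm_inf_1 ?M (adjacency_operator V adj) \<le> ennreal (real (card V))"
    unfolding norm_inf_1_def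
  proof (rule SUP_least)
    fix f assume f: "f \<in> Linf_ball ?M"
    have "(\<integral>\<^sup>+x. ennreal \<bar>adjacency_operator V adj f x\<bar> \<partial>?M)
        \<le> (\<integral>\<^sup>+x. ennreal (real (card V)) \<partial>?M)"
      by (intro nn_integral_mono ennreal_leI bd f)
    then show "(\<integral>\<^sup>+x. ennreal \<bar>adjacency_operator V adj f x\<bar> \<partial>?M) \<le> ennreal (real (card V))"
      by (simp add: emeasure_space_1)
  qed
  then have "norm_inf_1 ?M (adjacency_operator V adj) < \<infinity>"
    by (simp add: order_le_less_trans[OF _ ennreal_less_top])
  then show ?thesis
    unfolding P_operator_def AE
    by (auto simp: int prob_space_axioms adjacency_operator_def sum.distrib sum_distrib_left
             intro!: sum.cong)
qed

section \<open>Ultrafilters of sets of positive measure\<close>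

definition positive_filter :: "'a measure \<Rightarrow> 'a set set \<Rightarrow> bool" where
  "positive_filter M U \<longleftrightarrow>
     (\<forall>E\<in>U. E \<in> sets M \<and> 0 < emeasure M E) \<and>
     (\<forall>E\<in>U. \<forall>F\<in>U. E \<inter> F \<in> U) \<and>
     (\<forall>E\<in>U. \<forall>F\<in>sets M. E \<subseteq> F \<longrightarrow> F \<in> U)"

definition measure_ultrafilter :: "'a measure \<Rightarrow> 'a set set \<Rightarrow> bool" where
  "measure_ultrafilter M U \<longleftrightarrow>
     positive_filter M U \<and> (\<forall>W. positive_filter M W \<and> U \<subseteq> W \<longrightarrow> W = U)"

definition delta :: "'a set set \<Rightarrow> 'a set \<Rightarrow> real" where
  "delta U E = (if E \<in> U then 1 else 0)"

text \<open>
  The limit is required for every sequence of simple functions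
  \<open>\<Sum>i<m n. \<alpha> n i * indicator (E n i)\<close> converging to \<open>f\<close> in \<open>L\<^sup>\<infinity>\<close>; the value is thus
  independent of the sequence and of the representations of its members.
\<close>

definition has_delta_integral :: "'a measure \<Rightarrow> 'a set set \<Rightarrow> ('a \<Rightarrow> real) \<Rightarrow> real \<Rightarrow> bool" where
  "has_delta_integral M U f l \<longleftrightarrow> f \<in> Linf M \<and>
     (\<forall>(m :: nat \<Rightarrow> nat) (\<alpha> :: nat \<Rightarrow> nat \<Rightarrow> real) (E :: nat \<Rightarrow> nat \<Rightarrow> 'a set).
        (\<forall>n. \<forall>i<m n. E n i \<in> sets M) \<and>
        (\<lambda>n. Linf_norm M (\<lambda>x. (\<Sum>i<m n. \<alpha> n i * indicator (E n i) x) - f x)) \<longlonglongrightarrow> 0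
        \<longrightarrow> (\<lambda>n. \<Sum>i<m n. \<alpha> n i * delta U (E n i)) \<longlonglongrightarrow> l)"

definition delta_integral :: "'a measure \<Rightarrow> 'a set set \<Rightarrow> ('a \<Rightarrow> real) \<Rightarrow> real" where
  "delta_integral M U f = (THE l. has_delta_integral M U f l)"

abbreviation lebesgue01 :: "real measure" where
  "lebesgue01 \<equiv> restrict_space lborel {0..<1}"

definition delta_operator :: "real set set \<Rightarrow> (real \<Rightarrow> real) \<Rightarrow> real \<Rightarrow> real" where
  "delta_operator U f x = delta_integral lebesgue01 U f * indicator {0..<1} x"

end

theory Submission
  imports Defs
begin

text \<open>
  The integral of \<open>f\<close> against \<open>\<delta>\<^sub>U\<close> is the limit of \<open>f\<close> along the ultrafilter, so \<open>A f\<close> is the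
  constant \<open>lim\<^sub>U f\<close>. On the star, \<open>S\<^sub>n v\<close> equals \<open>v(c)\<close> at every vertex other than the center \<open>c\<close>, and
  \<open>c\<close> has mass \<open>1/n\<close>. Given \<open>v\<close>, cut \<open>[0,1)\<close> into \<open>n\<close> intervals of length \<open>1/n\<close>; exactly one of them
  lies in \<open>U\<close>, and the step function taking the value \<open>v(c)\<close> there and the remaining values of \<open>v\<close> on
  the other intervals has \<open>U\<close>-limit \<open>v(c)\<close>. Conversely, given \<open>f\<^sub>1,\<dots>,f\<^sub>k\<close>, put \<open>lim\<^sub>U f\<^sub>i\<close> at
  the center and distribute values of \<open>f\<close> over the leaves so that each cell of a fine grid in
  \<open>[-1,1]\<^sup>k\<close> gets its proportion up to \<open>2/n\<close>; the number of cells does not depend on \<open>f\<close>, so the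
  estimate is uniform over the profile.
\<close>

section \<open>Essentially bounded functions and their approximation by simple functions\<close>

lemma esssup_le_iff:
  assumes "f \<in> borel_measurable M"
  shows "esssup M f \<le> c \<longleftrightarrow> (AE x in M. f x \<le> c)"
  using assms esssup_AE[of f M] by (auto intro: order_trans)

lemma Linf_norm_le_iff:
  assumes "f \<in> borel_measurable M"
  shows "Linf_norm M f \<le> ereal c \<longleftrightarrow> (AE x in M. \<bar>f x\<bar> \<le> c)"
  using assms unfolding Linf_norm_def by (subst esssup_le_iff) auto

lemma Linf_iff: "f \<in> Linf M \<longleftrightarrow> f \<in> borel_measurable M \<and> (\<exists>c. AE x in M. \<bar>f x\<bar> \<le> c)"
proof -
  have "(\<exists>c. Linf_norm M f \<le> ereal c) \<longleftrightarrow> Linf_norm M f < \<infinity>"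
    by (cases "Linf_norm M f") auto
  then show ?thesis
    using Linf_norm_le_iff[of f M] by (auto simp: Linf_def)
qed

lemma Linf_ball_iff: "f \<in> Linf_ball M \<longleftrightarrow> f \<in> borel_measurable M \<and> (AE x in M. \<bar>f x\<bar> \<le> 1)"
  using Linf_norm_le_iff[of f M 1] Linf_iff[of f M] unfolding Linf_ball_def one_ereal_def by blast

lemma Linf_linear_combination:
  assumes "f \<in> Linf M" "g \<in> Linf M"
  shows "(\<lambda>x. a * f x + b * g x) \<in> Linf M"
proof -
  obtain c d where "AE x in M. \<bar>f x\<bar> \<le> c" "AE x in M. \<bar>g x\<bar> \<le> d"
    using assms by (auto simp: Linf_iff)
  then have "AE x in M. \<bar>a * f x + b * g x\<bar> \<le> \<bar>a\<bar> * c + \<bar>b\<bar> * d"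
  proof eventually_elim
    case (elim x)
    have "\<bar>a * f x + b * g x\<bar> \<le> \<bar>a\<bar> * \<bar>f x\<bar> + \<bar>b\<bar> * \<bar>g x\<bar>"
      by (metis abs_mult abs_triangle_ineq)
    also have "\<dots> \<le> \<bar>a\<bar> * c + \<bar>b\<bar> * d"
      using elim by (intro add_mono mult_left_mono) auto
    finally show ?case .
  qed
  then show ?thesis using assms by (auto simp: Linf_iff)
qed

text \<open>With an essential bound \<open>c\<close>, the function \<open>f + c\<close> is rounded
  down to multiples of 1/(n+1). Since \<open>has_delta_integral\<close> quantifies over all
  approximating sequences, it determines a value only if at least one such sequence exists; this
  lemma supplies it. A nonnull space keeps the essential supremum of a nonnegative function
  nonnegative.\<close>

lemma Linf_simple_approximation:
  assumes "f \<in> Linf M" "emeasure M (space M) \<noteq> 0"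
  obtains E :: "nat \<Rightarrow> nat \<Rightarrow> 'a set" and \<alpha> :: "nat \<Rightarrow> nat \<Rightarrow> real" and m :: "nat \<Rightarrow> nat"
  where "\<And>n i. E n i \<in> sets M"
    and "(\<lambda>n. Linf_norm M (\<lambda>x. (\<Sum>i<m n. \<alpha> n i * indicator (E n i) x) - f x)) \<longlonglongrightarrow> 0"
proof -
  from assms(1) have f[measurable]: "f \<in> borel_measurable M" by (simp add: Linf_iff)
  from assms(1) obtain c where c: "AE x in M. \<bar>f x\<bar> \<le> c" by (auto simp: Linf_iff)
  \<comment> \<open>Almost everywhere \<open>f x + c\<close> lies between 0 and
    \<open>2 * c\<close>, so the cell index is at most the floor of
    \<open>2 * c * real (Suc n)\<close>; the added 1 keeps that last index in range.\<close>
  define m where "m n = nat \<lfloor>2 * c * real (Suc n)\<rfloor> + 1" for n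
  define \<alpha> where "\<alpha> n i = real i / real (Suc n) - c" for n i
  define E where "E n i = {x \<in> space M. \<lfloor>(f x + c) * real (Suc n)\<rfloor> = int i}" for n i
  have E[measurable]: "E n i \<in> sets M" for n i
    unfolding E_def by measurable
  let ?s = "\<lambda>n x. (\<Sum>i<m n. \<alpha> n i * indicator (E n i) x) - f x"
  have up: "Linf_norm M (?s n) \<le> ereal (1 / real (Suc n))" for n
  proof (subst Linf_norm_le_iff)
    show "AE x in M. \<bar>?s n x\<bar> \<le> 1 / real (Suc n)"
      using c AE_space
    proof eventually_elim
      case (elim x)
      define r where "r = (f x + c) * real (Suc n)"
      define j where "j = nat \<lfloor>r\<rfloor>"
      have "0 \<le> r" using elim by (auto simp: r_def)
      then have j: "\<lfloor>r\<rfloor> = int j" by (simp add: j_def)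
      have "r \<le> 2 * c * real (Suc n)"
        using elim unfolding r_def by (intro mult_right_mono) auto
      then have "j < m n" unfolding j_def m_def by (simp add: nat_mono floor_mono less_Suc_eq_le)
      have ind: "indicator (E n i) x = (if i = j then 1 else 0 :: real)" for i
        using elim j by (auto simp: E_def r_def indicator_def)
      have "(\<Sum>i<m n. \<alpha> n i * indicator (E n i) x) = \<alpha> n j"
        using \<open>j < m n\<close> unfolding ind by (simp add: if_distrib[of "(*) _"] cong: if_cong)
      moreover have "real j \<le> r" "r < real j + 1" using j by linarith+
      then have "real j / real (Suc n) \<le> f x + c" "f x + c \<le> (real j + 1) / real (Suc n)"
        unfolding r_def by (simp_all add: field_simps del: of_nat_Suc)
      ultimately show ?case unfolding \<alpha>_def by (simp add: add_divide_distrib abs_le_iff del: of_nat_Suc)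
    qed
  qed measurable
  have "(\<lambda>n. Linf_norm M (?s n)) \<longlonglongrightarrow> 0"
  proof (rule tendsto_sandwich[OF always_eventually always_eventually tendsto_const])
    show "\<forall>n. 0 \<le> Linf_norm M (?s n)"
    proof
      fix n
      have "esssup M (\<lambda>x. 0 :: ereal) \<le> Linf_norm M (?s n)"
        unfolding Linf_norm_def by (rule esssup_mono) auto
      then show "0 \<le> Linf_norm M (?s n)" using assms(2) by (simp add: esssup_const)
    qed
    show "\<forall>n. Linf_norm M (?s n) \<le> ereal (1 / real (Suc n))" using up by auto
    show "(\<lambda>n. ereal (1 / real (Suc n))) \<longlonglongrightarrow> 0"
      using LIMSEQ_inverse_real_of_nat by (simp add: zero_ereal_def inverse_eq_divide)
  qed
  with E show thesis by (rule that)
qed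

section \<open>Ultrafilter properties of maximal families of sets of positive measure\<close>

locale positive_ultrafilter = prob_space M for M :: "'a measure" +
  fixes U :: "'a set set"
  assumes ultrafilter: "measure_ultrafilter M U"
begin

lemma filter_U: "positive_filter M U"
  using ultrafilter unfolding measure_ultrafilter_def by (rule conjunct1)

lemma sets_U: "E \<in> U \<Longrightarrow> E \<in> sets M"
  and positive_U: "E \<in> U \<Longrightarrow> 0 < emeasure M E"
  using filter_U[unfolded positive_filter_def, THEN conjunct1] by blast+

lemma Int_U: "E \<in> U \<Longrightarrow> F \<in> U \<Longrightarrow> E \<inter> F \<in> U"
  using filter_U[unfolded positive_filter_def, THEN conjunct2, THEN conjunct1] by blast

lemma superset_U: "E \<in> U \<Longrightarrow> F \<in> sets M \<Longrightarrow> E \<subseteq> F \<Longrightarrow> F \<in> U"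
  using filter_U[unfolded positive_filter_def, THEN conjunct2, THEN conjunct2] by blast

lemma maximal_U: "positive_filter M W \<Longrightarrow> U \<subseteq> W \<Longrightarrow> W = U"
  using ultrafilter by (simp add: measure_ultrafilter_def)

lemma nonempty_U: "E \<in> U \<Longrightarrow> E \<noteq> {}"
  using positive_U[of E] by auto

text \<open>The empty family is itself a positive filter; maximality excludes it by comparison with
  \<open>{space M}\<close>, and any member of \<open>U\<close> can then be enlarged to the whole
  space.\<close>

lemma space_U: "space M \<in> U"
proof -
  have "E = space M" if "E \<in> sets M" "space M \<subseteq> E" for E
    using that sets.sets_into_space[of E M] by blast
  then have "positive_filter M {space M}"
    unfolding positive_filter_def by (simp add: emeasure_space_1)
  then have "U \<noteq> {}" using maximal_U[of "{space M}"] by blast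
  then obtain E where E: "E \<in> U" by blast
  show ?thesis by (rule superset_U[OF E sets.top sets.sets_into_space[OF sets_U[OF E]]])
qed

text \<open>The supersets of the sets \<open>F \<inter> E\<close> with \<open>F \<in> U\<close> form
  the filter generated by \<open>U\<close> and \<open>E\<close>. The assumption makes all of them
  positive, so maximality forces this filter to be \<open>U\<close>.\<close>

lemma positive_Int_in_U:
  assumes E: "E \<in> sets M" and pos: "\<And>F. F \<in> U \<Longrightarrow> 0 < emeasure M (F \<inter> E)"
  shows "E \<in> U"
proof -
  define W where "W = {G \<in> sets M. \<exists>F\<in>U. F \<inter> E \<subseteq> G}"
  have "positive_filter M W"
    unfolding positive_filter_def
  proof (intro conjI ballI impI)
    fix G assume "G \<in> W"
    then obtain F where F: "F \<in> U" "F \<inter> E \<subseteq> G" and G: "G \<in> sets M" unfolding W_def by blast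
    show "G \<in> sets M" by (rule G)
    show "0 < emeasure M G"
      using pos[OF F(1)] emeasure_mono[OF F(2) G] by (rule less_le_trans)
  next
    fix G H assume "G \<in> W" "H \<in> W"
    then obtain F F' where F: "F \<in> U" "F \<inter> E \<subseteq> G" "F' \<in> U" "F' \<inter> E \<subseteq> H"
      and GH: "G \<in> sets M" "H \<in> sets M"
      unfolding W_def by blast
    have "F \<inter> F' \<in> U" "F \<inter> F' \<inter> E \<subseteq> G \<inter> H" using F Int_U[of F F'] by blast+
    then show "G \<inter> H \<in> W" using sets.Int[OF GH] unfolding W_def by blast
  next
    fix G H assume "G \<in> W" "H \<in> sets M" "G \<subseteq> H"
    then show "H \<in> W" unfolding W_def by blast
  qed
  moreover have "U \<subseteq> W" using sets_U unfolding W_def by blast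
  ultimately have "W = U" by (rule maximal_U)
  moreover have "E \<in> W" using E space_U unfolding W_def by blast
  ultimately show ?thesis by blast
qed

text \<open>Intersecting with a conull set does not change measures. In this way bounds that hold
  almost everywhere become statements about \<open>U\<close>.\<close>

lemma AE_in_U:
  assumes "E \<in> sets M" "AE x in M. x \<in> E"
  shows "E \<in> U"
proof (rule positive_Int_in_U[OF assms(1)])
  fix F assume F: "F \<in> U"
  have "emeasure M (F \<inter> E) = emeasure M F"
  proof (rule emeasure_eq_AE)
    show "AE x in M. x \<in> F \<inter> E \<longleftrightarrow> x \<in> F" using assms(2) by eventually_elim simp
  qed (use assms(1) sets_U[OF F] in blast)+
  with positive_U[OF F] show "0 < emeasure M (F \<inter> E)" by simp
qed

lemma AE_Collect_in_U:
  assumes "AE x in M. P x" "{x \<in> space M. P x} \<in> sets M"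
  shows "{x \<in> space M. P x} \<in> U"
proof (rule AE_in_U[OF assms(2)])
  show "AE x in M. x \<in> {x \<in> space M. P x}" using assms(1) AE_space by eventually_elim simp
qed

lemma AE_abs_le_in_U:
  fixes f :: "'a \<Rightarrow> real"
  assumes [measurable]: "f \<in> borel_measurable M" and "AE x in M. \<bar>f x\<bar> \<le> c"
  shows "{x \<in> space M. \<bar>f x\<bar> \<le> c} \<in> U"
  by (rule AE_Collect_in_U[OF assms(2)]) measurable

text \<open>Since \<open>E\<close> is not in \<open>U\<close>, some \<open>F \<in> U\<close> meets
  \<open>E\<close> in a null set. For any \<open>G \<in> U\<close> the positive set
  \<open>G \<inter> F\<close> then lies outside \<open>E\<close> up to a null set.\<close>

lemma compl_in_U:
  assumes E: "E \<in> sets M" and "E \<notin> U"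
  shows "space M - E \<in> U"
proof (rule positive_Int_in_U)
  show "space M - E \<in> sets M" using E by (rule sets.compl_sets)
  have "\<exists>F\<in>U. \<not> 0 < emeasure M (F \<inter> E)"
    using assms positive_Int_in_U[OF E] by blast
  then obtain F where F: "F \<in> U" "emeasure M (F \<inter> E) = 0" by auto
  fix G assume G: "G \<in> U"
  have "0 < emeasure M (G \<inter> F)" by (intro positive_U Int_U F G)
  also have "emeasure M (G \<inter> F) \<le> emeasure M (G \<inter> (space M - E) \<union> F \<inter> E)"
  proof (rule emeasure_mono)
    show "G \<inter> F \<subseteq> G \<inter> (space M - E) \<union> F \<inter> E"
      using sets.sets_into_space[OF sets_U[OF G]] by blast
    show "G \<inter> (space M - E) \<union> F \<inter> E \<in> sets M"
      using E sets_U[OF G] sets_U[OF F(1)] by (intro sets.Un sets.Int sets.compl_sets)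
  qed
  also have "\<dots> \<le> emeasure M (G \<inter> (space M - E)) + emeasure M (F \<inter> E)"
    using E sets_U[OF G] sets_U[OF F(1)] by (intro emeasure_subadditive sets.Int sets.compl_sets)
  also have "\<dots> = emeasure M (G \<inter> (space M - E))" unfolding F(2) by (rule add_0_right)
  finally show "0 < emeasure M (G \<inter> (space M - E))" .
qed

lemma INT_in_U:
  assumes "finite I" "\<And>i. i \<in> I \<Longrightarrow> E i \<in> U"
  shows "space M \<inter> (\<Inter>i\<in>I. E i) \<in> U"
  using assms
proof (induction I)
  case (insert i I)
  have "E i \<in> U" "space M \<inter> (\<Inter>i\<in>I. E i) \<in> U"
    using insert.prems insert.IH by blast+
  then have "E i \<inter> (space M \<inter> (\<Inter>i\<in>I. E i)) \<in> U" by (rule Int_U)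
  also have "E i \<inter> (space M \<inter> (\<Inter>i\<in>I. E i)) = space M \<inter> (\<Inter>i\<in>insert i I. E i)" by blast
  finally show ?case .
qed (simp add: space_U)

text \<open>If no \<open>E i\<close> were in \<open>U\<close>, all complements would be, and their
  finite intersection would be an empty member of \<open>U\<close>.\<close>

lemma finite_UN_in_U:
  assumes "finite I" "\<And>i. i \<in> I \<Longrightarrow> E i \<in> sets M" "space M \<subseteq> (\<Union>i\<in>I. E i)"
  obtains i where "i \<in> I" "E i \<in> U"
proof -
  have "\<exists>i\<in>I. E i \<in> U"
  proof (rule ccontr)
    assume "\<not> (\<exists>i\<in>I. E i \<in> U)"
    then have "space M - E i \<in> U" if "i \<in> I" for i
      using that compl_in_U[OF assms(2)[OF that]] by blast
    then have "space M \<inter> (\<Inter>i\<in>I. space M - E i) \<noteq> {}"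
      by (intro nonempty_U INT_in_U assms(1))
    then show False using assms(3) by blast
  qed
  then show thesis using that by blast
qed

section \<open>Limits along the ultrafilter and the integral against \<open>delta U\<close>\<close>

definition ulim :: "('a \<Rightarrow> real) \<Rightarrow> real \<Rightarrow> bool" where
  "ulim f l \<longleftrightarrow> (\<forall>e>0. {x \<in> space M. \<bar>f x - l\<bar> \<le> e} \<in> U)"

text \<open>The limit is the supremum of the levels \<open>t\<close> for which the set where
  \<open>t \<le> f x\<close> belongs to \<open>U\<close>; the essential bound makes this set of
  levels nonempty and bounded above.\<close>

lemma ulim_exists:
  assumes "f \<in> Linf M"
  obtains l where "ulim f l"
proof -
  from assms have f[measurable]: "f \<in> borel_measurable M" by (simp add: Linf_iff)
  from assms obtain c where c: "AE x in M. \<bar>f x\<bar> \<le> c" by (auto simp: Linf_iff)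
  define T where "T = {t. {x \<in> space M. t \<le> f x} \<in> U}"
  have down: "s \<in> T" if "t \<in> T" "s \<le> t" for s t
  proof -
    have "{x \<in> space M. t \<le> f x} \<in> U" using that(1) by (simp add: T_def)
    then have "{x \<in> space M. s \<le> f x} \<in> U" by (rule superset_U) (use that(2) in auto)
    then show ?thesis by (simp add: T_def)
  qed
  have "- c \<in> T" unfolding T_def mem_Collect_eq
    by (rule AE_Collect_in_U) (use c in auto)
  moreover have bd: "t \<le> c" if "t \<in> T" for t
  proof -
    have "{x \<in> space M. f x \<le> c} \<in> U"
      by (rule AE_Collect_in_U) (use c in auto)
    with that have "{x \<in> space M. t \<le> f x} \<inter> {x \<in> space M. f x \<le> c} \<noteq> {}"
      unfolding T_def by (intro nonempty_U Int_U) auto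
    then show ?thesis by auto
  qed
  ultimately have T: "T \<noteq> {}" "bdd_above T" by (auto simp: bdd_above_def)
  have "ulim f (Sup T)"
    unfolding ulim_def
  proof (intro allI impI)
    fix e :: real assume "0 < e"
    then obtain t where "t \<in> T" "Sup T - e < t" using less_cSupD[OF T(1), of "Sup T - e"] by auto
    then have "{x \<in> space M. Sup T - e \<le> f x} \<in> U" using down[of t "Sup T - e"] by (auto simp: T_def)
    \<comment> \<open>A level above the supremum fails, so by the ultrafilter property the
      complement is in \<open>U\<close>; this gives the upper half of the estimate.\<close>
    moreover have "Sup T + e \<notin> T" using cSup_upper[OF _ T(2), of "Sup T + e"] \<open>0 < e\<close> by auto
    then have "space M - {x \<in> space M. Sup T + e \<le> f x} \<in> U"
      unfolding T_def mem_Collect_eq by (intro compl_in_U) auto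
    ultimately have "{x \<in> space M. Sup T - e \<le> f x} \<inter> (space M - {x \<in> space M. Sup T + e \<le> f x}) \<in> U"
      by (rule Int_U)
    then show "{x \<in> space M. \<bar>f x - Sup T\<bar> \<le> e} \<in> U"
      by (rule superset_U) auto
  qed
  then show thesis by (rule that)
qed

text \<open>For each \<open>i\<close> either \<open>E i\<close> or its complement is in
  \<open>U\<close>. On the intersection of these choices every indicator is constant, with value
  \<open>delta U (E i)\<close>.\<close>

lemma simple_eq_delta_in_U:
  fixes m :: nat
  assumes "\<And>i. i < m \<Longrightarrow> E i \<in> sets M"
  shows "{x \<in> space M. (\<Sum>i<m. \<alpha> i * indicator (E i) x) = (\<Sum>i<m. \<alpha> i * delta U (E i))} \<in> U" (is "?S \<in> U")
proof -
  define F where "F i = (if E i \<in> U then E i else space M - E i)" for i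
  have "space M \<inter> (\<Inter>i\<in>{..<m}. F i) \<in> U"
  proof (rule INT_in_U)
    show "F i \<in> U" if "i \<in> {..<m}" for i
      using that compl_in_U[OF assms, of i] by (simp add: F_def)
  qed simp
  then show ?thesis
  proof (rule superset_U)
    have "(\<lambda>x. \<Sum>i<m. \<alpha> i * indicator (E i) x) \<in> borel_measurable M"
      using assms by (intro borel_measurable_sum) auto
    then show "?S \<in> sets M" by measurable
    show "space M \<inter> (\<Inter>i\<in>{..<m}. F i) \<subseteq> ?S"
    proof
      fix x assume x: "x \<in> space M \<inter> (\<Inter>i\<in>{..<m}. F i)"
      have "indicator (E i) x = delta U (E i)" if "i < m" for i
      proof -
        have "x \<in> F i" using x that by blast
        then show ?thesis by (simp add: F_def delta_def split: if_splits)
      qed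
      then have "(\<Sum>i<m. \<alpha> i * indicator (E i) x) = (\<Sum>i<m. \<alpha> i * delta U (E i))"
        by (intro sum.cong refl) simp
      then show "x \<in> ?S" using x by blast
    qed
  qed
qed

text \<open>Three sets belong to \<open>U\<close> for large \<open>n\<close>: where the simple
  function is near \<open>f\<close>, where \<open>f\<close> is near \<open>l\<close>, and where the
  simple function equals its own \<open>delta U\<close> sum. A single point common to all three
  compares that sum with \<open>l\<close>.\<close>

lemma has_delta_integral_ulim:
  assumes f: "f \<in> Linf M" and l: "ulim f l"
  shows "has_delta_integral M U f l"
  unfolding has_delta_integral_def
proof (intro conjI allI impI f)
  from f have fm[measurable]: "f \<in> borel_measurable M" by (simp add: Linf_iff)
  fix m :: "nat \<Rightarrow> nat" and \<alpha> :: "nat \<Rightarrow> nat \<Rightarrow> real" and E :: "nat \<Rightarrow> nat \<Rightarrow> 'a set"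
  let ?s = "\<lambda>n x. \<Sum>i<m n. \<alpha> n i * indicator (E n i) x"
  assume "(\<forall>n. \<forall>i<m n. E n i \<in> sets M) \<and> (\<lambda>n. Linf_norm M (\<lambda>x. ?s n x - f x)) \<longlonglongrightarrow> 0"
  then have *: "\<And>n i. i < m n \<Longrightarrow> E n i \<in> sets M" "(\<lambda>n. Linf_norm M (\<lambda>x. ?s n x - f x)) \<longlonglongrightarrow> 0"
    by blast+
  have "?s n \<in> borel_measurable M" for n
    by (intro borel_measurable_sum borel_measurable_times borel_measurable_const borel_measurable_indicator *(1)) simp
  then have sm: "(\<lambda>x. ?s n x - f x) \<in> borel_measurable M" for n
    using fm by (rule borel_measurable_diff)
  show "(\<lambda>n. \<Sum>i<m n. \<alpha> n i * delta U (E n i)) \<longlonglongrightarrow> l"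
  proof (rule tendstoI)
    fix e :: real assume "0 < e"
    then have "eventually (\<lambda>n. Linf_norm M (\<lambda>x. ?s n x - f x) < ereal (e / 3)) sequentially"
      by (intro order_tendstoD(2)[OF *(2)]) simp
    then show "eventually (\<lambda>n. dist (\<Sum>i<m n. \<alpha> n i * delta U (E n i)) l < e) sequentially"
    proof eventually_elim
      case (elim n)
      then have ae: "AE x in M. \<bar>?s n x - f x\<bar> \<le> e / 3"
        by (intro Linf_norm_le_iff[THEN iffD1] sm less_imp_le)
      have "{x \<in> space M. \<bar>?s n x - f x\<bar> \<le> e / 3} \<in> U"
        by (rule AE_abs_le_in_U[OF sm ae])
      moreover have "{x \<in> space M. \<bar>f x - l\<bar> \<le> e / 3} \<in> U"
        using l[unfolded ulim_def, rule_format, of "e / 3"] \<open>0 < e\<close> by simp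
      moreover have "{x \<in> space M. ?s n x = (\<Sum>i<m n. \<alpha> n i * delta U (E n i))} \<in> U"
        by (intro simple_eq_delta_in_U *(1))
      ultimately have "{x \<in> space M. \<bar>?s n x - f x\<bar> \<le> e / 3} \<inter> ({x \<in> space M. \<bar>f x - l\<bar> \<le> e / 3}
          \<inter> {x \<in> space M. ?s n x = (\<Sum>i<m n. \<alpha> n i * delta U (E n i))}) \<noteq> {}"
        by (intro nonempty_U Int_U)
      then obtain x where x: "\<bar>?s n x - f x\<bar> \<le> e / 3" "\<bar>f x - l\<bar> \<le> e / 3"
        and eq: "?s n x = (\<Sum>i<m n. \<alpha> n i * delta U (E n i))"
        by blast
      have "dist a l < e" if "\<bar>a - b\<bar> \<le> e / 3" "\<bar>b - l\<bar> \<le> e / 3" for a b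
        using that \<open>0 < e\<close> unfolding dist_real_def by linarith
      from this[OF x] show ?case unfolding eq .
    qed
  qed
qed

text \<open>This turns the definite description into a limit along \<open>U\<close>. For uniqueness,
  two candidate values are limits of the same numbers along one concrete approximating
  sequence.\<close>

lemma delta_integral_eq:
  assumes f: "f \<in> Linf M" and l: "ulim f l"
  shows "delta_integral M U f = l"
  unfolding delta_integral_def
proof (rule the_equality)
  show "has_delta_integral M U f l" by (rule has_delta_integral_ulim[OF assms])
  fix l' assume l': "has_delta_integral M U f l'"
  have "emeasure M (space M) \<noteq> 0" by (simp add: emeasure_space_1)
  with f obtain E :: "nat \<Rightarrow> nat \<Rightarrow> 'a set" and \<alpha> :: "nat \<Rightarrow> nat \<Rightarrow> real" and m :: "nat \<Rightarrow> nat"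
    where E: "\<And>n i. E n i \<in> sets M"
    and lim: "(\<lambda>n. Linf_norm M (\<lambda>x. (\<Sum>i<m n. \<alpha> n i * indicator (E n i) x) - f x)) \<longlonglongrightarrow> 0"
    by (rule Linf_simple_approximation) (rule that)
  have "(\<lambda>n. \<Sum>i<m n. \<alpha> n i * delta U (E n i)) \<longlonglongrightarrow> k" if "has_delta_integral M U f k" for k
    using that[unfolded has_delta_integral_def, THEN conjunct2, THEN spec[of _ m], THEN spec[of _ \<alpha>],
        THEN spec[of _ E]] E lim by blast
  from this[OF l'] this[OF has_delta_integral_ulim[OF assms]] show "l' = l"
    by (rule LIMSEQ_unique)
qed

lemma ulim_delta_integral:
  assumes "f \<in> Linf M"
  shows "ulim f (delta_integral M U f)"
proof -
  obtain l where l: "ulim f l" using assms by (rule ulim_exists)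
  with delta_integral_eq[OF assms l] show ?thesis by simp
qed

lemma ulim_cong_AE:
  assumes "ulim f l" "AE x in M. f x = g x" and [measurable]: "f \<in> borel_measurable M" "g \<in> borel_measurable M"
  shows "ulim g l"
  unfolding ulim_def
proof (intro allI impI)
  fix e :: real assume "0 < e"
  have "{x \<in> space M. f x = g x} \<in> U"
    by (rule AE_Collect_in_U[OF assms(2)]) measurable
  moreover have "{x \<in> space M. \<bar>f x - l\<bar> \<le> e} \<in> U"
    using assms(1) \<open>0 < e\<close> by (simp add: ulim_def)
  ultimately have "{x \<in> space M. f x = g x} \<inter> {x \<in> space M. \<bar>f x - l\<bar> \<le> e} \<in> U" by (rule Int_U)
  then show "{x \<in> space M. \<bar>g x - l\<bar> \<le> e} \<in> U" by (rule superset_U) auto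
qed

lemma ulim_linear_combination:
  assumes f: "ulim f l" and g: "ulim g l'"
    and [measurable]: "f \<in> borel_measurable M" "g \<in> borel_measurable M"
  shows "ulim (\<lambda>x. a * f x + b * g x) (a * l + b * l')"
  unfolding ulim_def
proof (intro allI impI)
  fix e :: real assume "0 < e"
  \<comment> \<open>The 1 in the denominator covers the case where \<open>a\<close> and
    \<open>b\<close> both vanish.\<close>
  define d where "d = e / (\<bar>a\<bar> + \<bar>b\<bar> + 1)"
  have d: "0 < d" "(\<bar>a\<bar> + \<bar>b\<bar>) * d \<le> e"
    using \<open>0 < e\<close> by (auto simp: d_def field_simps)
  have "{x \<in> space M. \<bar>f x - l\<bar> \<le> d} \<inter> {x \<in> space M. \<bar>g x - l'\<bar> \<le> d} \<in> U"
    using f g d(1) by (intro Int_U) (auto simp: ulim_def)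
  then show "{x \<in> space M. \<bar>a * f x + b * g x - (a * l + b * l')\<bar> \<le> e} \<in> U"
  proof (rule superset_U)
    show "{x \<in> space M. \<bar>f x - l\<bar> \<le> d} \<inter> {x \<in> space M. \<bar>g x - l'\<bar> \<le> d}
      \<subseteq> {x \<in> space M. \<bar>a * f x + b * g x - (a * l + b * l')\<bar> \<le> e}"
    proof safe
      fix x assume x: "\<bar>f x - l\<bar> \<le> d" "\<bar>g x - l'\<bar> \<le> d"
      have "\<bar>a * f x + b * g x - (a * l + b * l')\<bar> = \<bar>a * (f x - l) + b * (g x - l')\<bar>"
        by (simp add: algebra_simps)
      also have "\<dots> \<le> \<bar>a\<bar> * \<bar>f x - l\<bar> + \<bar>b\<bar> * \<bar>g x - l'\<bar>"
        by (metis abs_mult abs_triangle_ineq)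
      also have "\<dots> \<le> \<bar>a\<bar> * d + \<bar>b\<bar> * d"
        using x by (intro add_mono mult_left_mono) auto
      also have "\<dots> \<le> e" using d(2) by (simp add: algebra_simps)
      finally show "\<bar>a * f x + b * g x - (a * l + b * l')\<bar> \<le> e" .
    qed
  qed measurable
qed

lemma delta_integral_cong_AE:
  assumes "f \<in> Linf M" "g \<in> Linf M" "AE x in M. f x = g x"
  shows "delta_integral M U f = delta_integral M U g"
proof -
  have "f \<in> borel_measurable M" "g \<in> borel_measurable M" using assms by (simp_all add: Linf_iff)
  then have "ulim g (delta_integral M U f)"
    by (rule ulim_cong_AE[OF ulim_delta_integral[OF assms(1)] assms(3)])
  then show ?thesis by (rule delta_integral_eq[OF assms(2), symmetric])
qed

lemma delta_integral_linear:
  assumes "f \<in> Linf M" "g \<in> Linf M"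
  shows "delta_integral M U (\<lambda>x. a * f x + b * g x) = a * delta_integral M U f + b * delta_integral M U g"
proof (rule delta_integral_eq[OF Linf_linear_combination[OF assms]])
  show "ulim (\<lambda>x. a * f x + b * g x) (a * delta_integral M U f + b * delta_integral M U g)"
    using assms by (intro ulim_linear_combination ulim_delta_integral) (simp_all add: Linf_iff)
qed

text \<open>Members of \<open>U\<close> are nonempty, so some point has \<open>f x\<close> in the
  unit interval around 0 and at the same time within \<open>e\<close> of the integral.\<close>

lemma abs_delta_integral_le_1:
  assumes "f \<in> Linf_ball M"
  shows "\<bar>delta_integral M U f\<bar> \<le> 1"
proof (rule field_le_epsilon)
  fix e :: real assume "0 < e"
  from assms have [measurable]: "f \<in> borel_measurable M" and ae: "AE x in M. \<bar>f x\<bar> \<le> 1"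
    by (auto simp: Linf_ball_iff)
  have "{x \<in> space M. \<bar>f x\<bar> \<le> 1} \<in> U"
    by (rule AE_abs_le_in_U[OF _ ae]) measurable
  moreover have "{x \<in> space M. \<bar>f x - delta_integral M U f\<bar> \<le> e} \<in> U"
    using ulim_delta_integral[of f] assms \<open>0 < e\<close> by (simp add: ulim_def Linf_ball_def)
  ultimately have "{x \<in> space M. \<bar>f x\<bar> \<le> 1} \<inter> {x \<in> space M. \<bar>f x - delta_integral M U f\<bar> \<le> e} \<noteq> {}"
    by (intro nonempty_U Int_U)
  then obtain x where "\<bar>f x\<bar> \<le> 1" "\<bar>f x - delta_integral M U f\<bar> \<le> e" by auto
  then show "\<bar>delta_integral M U f\<bar> \<le> 1 + e" by linarith
qed

end

section \<open>Stars and a finite selection principle\<close>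

text \<open>The count of leaves leaves exactly one other vertex \<open>c\<close>. The conclusion is
  all that is used of the graph: at each vertex other than \<open>c\<close>, the adjacency operator
  returns the value at \<open>c\<close>.\<close>

lemma star_graph_center:
  assumes star: "star_graph n V adj" and n: "3 \<le> n"
  obtains c where "finite V" "c \<in> V" "\<And>x. x \<in> V - {c} \<Longrightarrow> {y \<in> V. adj x y} = {c}"
proof -
  let ?L = "graph_leaves V adj"
  from star have sg: "simple_graph V adj" and conn: "graph_connected V adj"
    and card: "card V = n" "card ?L = n - 1"
    by (auto simp: star_graph_def graph_tree_def)
  then have fin: "finite V" and sym: "\<And>x y. adj x y \<Longrightarrow> adj y x"
    and inV: "\<And>x y. adj x y \<Longrightarrow> y \<in> V"
    by (auto simp: simple_graph_def)
  have "?L \<subseteq> V" by (auto simp: graph_leaves_def)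
  then have "card (V - ?L) = 1" using card n fin by (simp add: card_Diff_subset finite_subset)
  then obtain c where c: "V - ?L = {c}" by (auto simp: card_1_singleton_iff)
  have leaf: "\<exists>y. {y \<in> V. adj x y} = {y}" if "x \<in> ?L" for x
    using that by (auto simp: graph_leaves_def card_1_singleton_iff)
  have "{y \<in> V. adj x y} = {c}" if x: "x \<in> V - {c}" for x
  proof -
    from x c have "x \<in> ?L" by blast
    with leaf obtain y where y: "{y \<in> V. adj x y} = {y}" by blast
    have "y = c"
    proof (rule ccontr)
      assume "y \<noteq> c"
      with y c have "y \<in> ?L" by blast
      with leaf obtain z where z: "{z \<in> V. adj y z} = {z}" by blast
      moreover have "x \<in> {z \<in> V. adj y z}" using sym x y by blast
      ultimately have zx: "{z \<in> V. adj y z} = {x}" by (metis singletonD)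
      \<comment> \<open>Two adjacent leaves form a whole component.\<close>
      have "w \<in> {x, y}" if "adj\<^sup>*\<^sup>* x w" for w
        using that
      proof induction
        case (step v w)
        then have "w \<in> V" using inV by blast
        with step y zx show ?case by blast
      qed simp
      then have "V \<subseteq> {x, y}" using conn x unfolding graph_connected_def by blast
      then have "card V \<le> card {x, y}" by (intro card_mono) auto
      also have "\<dots> \<le> 2" by (simp add: card_insert_if)
      finally show False using card n by simp
    qed
    with y show ?thesis by simp
  qed
  then show thesis using that fin c by blast
qed

text \<open>Later \<open>W\<close> is the set of leaves and \<open>a j\<close> the number of leaves
  assigned to a grid cell. The induction varies \<open>W\<close>: after one subset is removed, the
  remaining ones are found in the rest.\<close>

lemma disjoint_family_of_cards:
  assumes "finite J" "finite W" "(\<Sum>j\<in>J. a j) \<le> card W"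
  obtains C where "\<And>j. j \<in> J \<Longrightarrow> C j \<subseteq> W" "\<And>j. j \<in> J \<Longrightarrow> card (C j) = a j" "disjoint_family_on C J"
proof -
  have "\<exists>C. (\<forall>j\<in>J. C j \<subseteq> W \<and> card (C j) = a j) \<and> disjoint_family_on C J"
    using assms
  proof (induction J arbitrary: W)
    case (insert i J)
    then have "a i \<le> card W" by simp
    then obtain D where D: "D \<subseteq> W" "card D = a i" "finite D" by (rule obtain_subset_with_card_n)
    have "(\<Sum>j\<in>J. a j) \<le> card (W - D)" "finite (W - D)"
      using insert D by (simp_all add: card_Diff_subset)
    from insert.IH[OF this(2,1)] obtain C where
      C: "\<forall>j\<in>J. C j \<subseteq> W - D \<and> card (C j) = a j" "disjoint_family_on C J" by blast
    have "disjoint_family_on (C(i := D)) (insert i J)"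
      using C insert.hyps by (auto simp: disjoint_family_on_def)
    moreover have "\<forall>j\<in>insert i J. (C(i := D)) j \<subseteq> W \<and> card ((C(i := D)) j) = a j"
      using C(1) D insert.hyps by auto
    ultimately show ?case by blast
  qed (simp add: disjoint_family_on_def)
  then show thesis using that by blast
qed

section \<open>Borel sets of Euclidean space and the Levy-Prokhorov distance\<close>

lemma space_Rn: "space (Rn d) = extensional {..<d}"
  by (simp add: Rn_def space_PiM PiE_def)

text \<open>The neighborhood is a union of open balls, possibly uncountable, so openness is used
  rather than countable operations. The distance involves finitely many coordinates and is
  continuous on the space of all sequences; the open set found there is pulled back along the
  inclusion, which is measurable because coordinates from \<open>d\<close> on are the constant
  \<open>undefined\<close>.\<close>

lemma Rn_nbhd_sets: "Rn_nbhd d e B \<in> sets (Rn d)"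
proof -
  let ?N = "\<Union>x\<in>B. {y :: nat \<Rightarrow> real. Rn_dist d x y < e}"
  have "open {y :: nat \<Rightarrow> real. Rn_dist d x y < e}" for x
    unfolding Rn_dist_def L2_set_def
    by (intro open_Collect_less continuous_intros continuous_on_product_coordinates)
  then have "?N \<in> sets borel" by (intro borel_open open_UN) simp
  then have "?N \<in> sets (Pi\<^sub>M UNIV (\<lambda>i::nat. borel :: real measure))" by (simp only: sets_PiM_equal_borel)
  moreover have "(\<lambda>y. y) \<in> Rn d \<rightarrow>\<^sub>M Pi\<^sub>M UNIV (\<lambda>i::nat. borel :: real measure)"
  proof (rule measurable_PiM_single')
    fix i :: nat
    show "(\<lambda>y. y i) \<in> borel_measurable (Rn d)"
    proof (cases "i < d")
      case True
      then show ?thesis unfolding Rn_def by (intro measurable_component_singleton) simp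
    next
      case False
      then have "y i = undefined" if "y \<in> space (Rn d)" for y
        using that by (auto simp: space_Rn extensional_def)
      then show ?thesis by (subst measurable_cong[where g = "\<lambda>_. undefined"]) auto
    qed
  qed auto
  ultimately have "(\<lambda>y. y) -` ?N \<inter> space (Rn d) \<in> sets (Rn d)" by (rule measurable_sets[rotated])
  also have "(\<lambda>y. y) -` ?N \<inter> space (Rn d) = Rn_nbhd d e B" by (auto simp: Rn_nbhd_def)
  finally show ?thesis .
qed

lemma LP_dist_le:
  assumes "0 < e"
    and "\<And>B. B \<in> sets (Rn d) \<Longrightarrow> measure \<mu> B \<le> measure \<nu> (Rn_nbhd d e B) + e"
    and "\<And>B. B \<in> sets (Rn d) \<Longrightarrow> measure \<nu> B \<le> measure \<mu> (Rn_nbhd d e B) + e"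
  shows "LP_dist d \<mu> \<nu> \<le> e"
  unfolding LP_dist_def using assms by (intro cInf_lower bdd_belowI[of _ 0]) auto

text \<open>For probability measures \<open>e = 1\<close> is always admissible, so the infimum is
  taken over a nonempty set of positive numbers.\<close>

lemma LP_dist_bounds:
  assumes "prob_space \<mu>" "prob_space \<nu>"
  shows "0 \<le> LP_dist d \<mu> \<nu>" "LP_dist d \<mu> \<nu> \<le> 1"
proof -
  interpret \<mu>: prob_space \<mu> by fact
  interpret \<nu>: prob_space \<nu> by fact
  have 1: "measure \<mu> B \<le> measure \<nu> C + 1" "measure \<nu> B \<le> measure \<mu> C + 1" for B C
    using \<mu>.prob_le_1[of B] \<nu>.prob_le_1[of B] measure_nonneg[of \<mu> C] measure_nonneg[of \<nu> C]
    by linarith+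
  then show "LP_dist d \<mu> \<nu> \<le> 1" by (intro LP_dist_le) auto
  have "1 \<in> {e. 0 < e \<and>
     (\<forall>B\<in>sets (Rn d). measure \<mu> B \<le> measure \<nu> (Rn_nbhd d e B) + e \<and>
                       measure \<nu> B \<le> measure \<mu> (Rn_nbhd d e B) + e)}" using 1 by simp
  then show "0 \<le> LP_dist d \<mu> \<nu>" unfolding LP_dist_def
    by (intro cInf_greatest) (blast, auto)
qed

lemma LP_dist_commute: "LP_dist d \<mu> \<nu> = LP_dist d \<nu> \<mu>"
  unfolding LP_dist_def by (simp add: conj_commute)

text \<open>Cells are matched: points of \<open>A j\<close> and \<open>C j\<close> have images less
  than \<open>e\<close> apart, and \<open>A j\<close> outweighs \<open>C j\<close> by at most
  \<open>\<eta> j\<close>. The cells \<open>A j\<close> meeting the preimage of \<open>B\<close>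
  carry its mass, and their partners \<open>C j\<close> are mapped into the neighborhood of
  \<open>B\<close>. The \<open>C j\<close> may leave out points, such as the center of a
  star.\<close>

lemma LP_dist_distr_le:
  assumes M: "prob_space M" and N: "prob_space N"
    and X: "X \<in> M \<rightarrow>\<^sub>M Rn d" and Y: "Y \<in> N \<rightarrow>\<^sub>M Rn d"
    and J: "finite J"
    and A: "\<And>j. j \<in> J \<Longrightarrow> A j \<in> sets M" "disjoint_family_on A J" "AE x in M. x \<in> (\<Union>j\<in>J. A j)"
    and C: "\<And>j. j \<in> J \<Longrightarrow> C j \<in> sets N" "disjoint_family_on C J"
    and AC: "\<And>j. j \<in> J \<Longrightarrow> measure M (A j) \<le> measure N (C j) + \<eta> j"
    and \<eta>: "\<And>j. j \<in> J \<Longrightarrow> 0 \<le> \<eta> j" "sum \<eta> J \<le> e" and e: "0 < e"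
    and close: "\<And>j x y. j \<in> J \<Longrightarrow> x \<in> A j \<Longrightarrow> y \<in> C j \<Longrightarrow> Rn_dist d (X x) (Y y) < e"
  shows "LP_dist d (distr M (Rn d) X) (distr N (Rn d) Y) \<le> e"
proof -
  interpret M: prob_space M by fact
  interpret N: prob_space N by fact
  note [measurable] = X Y
  have close': "Rn_dist d (Y y) (X x) < e" if "j \<in> J" "x \<in> A j" "y \<in> C j" for j x y
    using close[OF that] by (simp add: Rn_dist_def L2_set_def power2_commute)
  have cells: "measure M (\<Union>j\<in>I. A j) \<le> measure N (\<Union>j\<in>I. C j) + e" if "I \<subseteq> J" for I
  proof -
    have fin: "finite I" using J that by (rule rev_finite_subset)
    have "measure M (\<Union>j\<in>I. A j) = (\<Sum>j\<in>I. measure M (A j))"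
      using A that fin by (intro M.finite_measure_finite_Union) (auto simp: disjoint_family_on_def)
    also have "\<dots> \<le> (\<Sum>j\<in>I. measure N (C j) + \<eta> j)" using AC that by (intro sum_mono) auto
    also have "\<dots> = (\<Sum>j\<in>I. measure N (C j)) + sum \<eta> I" by (rule sum.distrib)
    also have "(\<Sum>j\<in>I. measure N (C j)) = measure N (\<Union>j\<in>I. C j)"
      using C that fin by (intro N.finite_measure_finite_Union[symmetric]) (auto simp: disjoint_family_on_def)
    also have "sum \<eta> I \<le> sum \<eta> J" using J that \<eta>(1) by (intro sum_mono2) auto
    finally show ?thesis using \<eta>(2) by simp
  qed
  have UA: "(\<Union>j\<in>I. A j) \<in> sets M" and UC: "(\<Union>j\<in>I. C j) \<in> sets N" if "I \<subseteq> J" for I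
    using A C that J by (auto intro!: sets.finite_UN intro: finite_subset)
  have XA: "X x \<in> space (Rn d)" if "x \<in> A j" "j \<in> J" for x j
    using measurable_space[OF X] sets.sets_into_space[OF A(1)[OF that(2)]] that by blast
  have YC: "Y y \<in> space (Rn d)" if "y \<in> C j" "j \<in> J" for y j
    using measurable_space[OF Y] sets.sets_into_space[OF C(1)[OF that(2)]] that by blast
  show ?thesis
  proof (rule LP_dist_le[OF e])
    fix B assume B[measurable]: "B \<in> sets (Rn d)"
    have nb[measurable]: "Rn_nbhd d e B \<in> sets (Rn d)" by (rule Rn_nbhd_sets)
    let ?X = "\<lambda>S. X -` S \<inter> space M" and ?Y = "\<lambda>S. Y -` S \<inter> space N"
    let ?\<mu> = "distr M (Rn d) X" and ?\<nu> = "distr N (Rn d) Y"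
    have mX: "measure ?\<mu> S = measure M (?X S)" "?X S \<in> sets M"
      and mY: "measure ?\<nu> S = measure N (?Y S)" "?Y S \<in> sets N" if "S \<in> sets (Rn d)" for S
      using that by (simp_all add: measure_distr)
    define I where "I = {j \<in> J. A j \<inter> ?X B \<noteq> {}}"
    have I: "I \<subseteq> J" by (auto simp: I_def)
    have "measure M (?X B) \<le> measure M (\<Union>j\<in>I. A j)"
    proof (rule M.finite_measure_mono_AE)
      show "AE x in M. x \<in> ?X B \<longrightarrow> x \<in> (\<Union>j\<in>I. A j)"
        using A(3) by eventually_elim (auto simp: I_def)
    qed (rule UA[OF I])
    also have "\<dots> \<le> measure N (\<Union>j\<in>I. C j) + e" by (rule cells[OF I])
    also have "measure N (\<Union>j\<in>I. C j) \<le> measure N (?Y (Rn_nbhd d e B))"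
    proof (rule N.finite_measure_mono)
      show "(\<Union>j\<in>I. C j) \<subseteq> ?Y (Rn_nbhd d e B)"
      proof
        fix y assume "y \<in> (\<Union>j\<in>I. C j)"
        then obtain j x where j: "j \<in> J" "y \<in> C j" "x \<in> A j" "X x \<in> B" by (auto simp: I_def)
        then show "y \<in> ?Y (Rn_nbhd d e B)"
          using close[of j x y] YC[of y j] sets.sets_into_space[OF C(1)[OF j(1)]] by (auto simp: Rn_nbhd_def)
      qed
    qed (rule mY(2)[OF nb])
    finally show "measure ?\<mu> B \<le> measure ?\<nu> (Rn_nbhd d e B) + e"
      by (simp add: mX(1)[OF B] mY(1)[OF nb])
    \<comment> \<open>The reverse inequality follows from the same one-sided comparison of cells, applied to the
      cells that \<open>Y\<close> does not use for \<open>B\<close>.\<close>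
    define K where "K = {j \<in> J. C j \<inter> ?Y B = {}}"
    have K: "K \<subseteq> J" by (auto simp: K_def)
    have "measure N (?Y B) \<le> measure N (space N - (\<Union>j\<in>K. C j))"
      using UC[OF K] by (intro N.finite_measure_mono) (auto simp: K_def)
    also have "\<dots> = 1 - measure N (\<Union>j\<in>K. C j)" by (rule N.prob_compl[OF UC[OF K]])
    also have "\<dots> \<le> 1 - measure M (\<Union>j\<in>K. A j) + e" using cells[OF K] by linarith
    also have "1 - measure M (\<Union>j\<in>K. A j) = measure M (space M - (\<Union>j\<in>K. A j))"
      by (rule M.prob_compl[OF UA[OF K], symmetric])
    \<comment> \<open>Almost every remaining point lies in some \<open>A j\<close> with
      \<open>j \<notin> K\<close>, and the partner \<open>C j\<close> contains a point that
      \<open>Y\<close> sends into \<open>B\<close>.\<close>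
    also have "\<dots> \<le> measure M (?X (Rn_nbhd d e B))"
    proof (rule M.finite_measure_mono_AE)
      show "AE x in M. x \<in> space M - (\<Union>j\<in>K. A j) \<longrightarrow> x \<in> ?X (Rn_nbhd d e B)"
        using A(3)
      proof eventually_elim
        case (elim x)
        show ?case
        proof
          assume x: "x \<in> space M - (\<Union>j\<in>K. A j)"
          with elim obtain j where j: "j \<in> J" "x \<in> A j" "j \<notin> K" by blast
          then obtain y where "y \<in> C j" "Y y \<in> B" by (auto simp: K_def)
          with j show "x \<in> ?X (Rn_nbhd d e B)"
            using close'[of j x y] XA[of x j] x by (auto simp: Rn_nbhd_def)
        qed
      qed
    qed (rule mX(2)[OF nb])
    finally show "measure ?\<nu> B \<le> measure ?\<mu> (Rn_nbhd d e B) + e"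
      by (simp add: mX(1)[OF nb] mY(1)[OF B])
  qed
qed

section \<open>Bounds for the Hausdorff distance\<close>

text \<open>One near partner bounds each infimum; nonnegativity of \<open>d\<close> supplies the
  lower bound that an infimum of reals needs for this.\<close>

lemma hausdorff_distance_le:
  assumes "X \<noteq> {}" "Y \<noteq> {}"
    and nonneg: "\<And>x y. x \<in> X \<Longrightarrow> y \<in> Y \<Longrightarrow> 0 \<le> d x y"
    and "\<And>x. x \<in> X \<Longrightarrow> \<exists>y\<in>Y. d x y \<le> e"
    and "\<And>y. y \<in> Y \<Longrightarrow> \<exists>x\<in>X. d x y \<le> e"
  shows "hausdorff_distance d X Y \<le> e"
proof -
  have "(INF y\<in>Y. d x y) \<le> e" if "x \<in> X" for x
    using assms(4)[OF that] nonneg that by (auto intro!: cINF_lower2 bdd_belowI2[where m = 0])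
  moreover have "(INF x\<in>X. d x y) \<le> e" if "y \<in> Y" for y
    using assms(5)[OF that] nonneg that by (auto intro!: cINF_lower2 bdd_belowI2[where m = 0])
  ultimately show ?thesis
    unfolding hausdorff_distance_def using assms(1,2) by (auto intro!: cSUP_least)
qed

text \<open>The upper bound \<open>c\<close> keeps the supremum of the infima finite, so that it
  dominates its members.\<close>

lemma hausdorff_distance_nonneg:
  assumes "X \<noteq> {}" "Y \<noteq> {}"
    and "\<And>x y. x \<in> X \<Longrightarrow> y \<in> Y \<Longrightarrow> 0 \<le> d x y"
    and "\<And>x y. x \<in> X \<Longrightarrow> y \<in> Y \<Longrightarrow> d x y \<le> c"
  shows "0 \<le> hausdorff_distance d X Y"
proof -
  obtain x y where xy: "x \<in> X" "y \<in> Y" using assms by blast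
  have "0 \<le> (INF y\<in>Y. d x y)" using assms xy by (intro cINF_greatest) auto
  also have "\<dots> \<le> (SUP x\<in>X. INF y\<in>Y. d x y)"
  proof (rule cSUP_upper[OF xy(1)], rule bdd_aboveI2)
    fix z assume "z \<in> X"
    then show "(INF y\<in>Y. d z y) \<le> c"
      using assms xy by (intro cINF_lower2[of _ _ y] bdd_belowI2[where m = 0]) auto
  qed
  finally show ?thesis by (simp add: hausdorff_distance_def max.coboundedI1)
qed

section \<open>Measurability and distances of joint distributions\<close>

lemma prob_space_lebesgue01: "prob_space lebesgue01"
  by (rule prob_space_restrict_space) auto

lemma space_lebesgue01: "space lebesgue01 = {0..<1}"
  by (simp add: space_restrict_space)

lemma delta_operator_measurable [measurable]: "delta_operator U f \<in> borel_measurable lebesgue01"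
proof -
  have "(\<lambda>x. delta_integral lebesgue01 U f * indicator {0..<1} x) \<in> borel_measurable lebesgue01"
    by (rule measurable_restrict_space1) measurable
  then show ?thesis by (simp add: delta_operator_def[abs_def])
qed

lemma AE_uniform_count_measure:
  assumes "finite V"
  shows "(AE x in uniform_count_measure V. P x) \<longleftrightarrow> (\<forall>x\<in>V. P x)"
  using assms unfolding uniform_count_measure_def
  by (subst AE_point_measure) (auto simp: card_gt_0_iff)

lemma Linf_ball_uniform_count_measure:
  assumes "finite V"
  shows "v \<in> Linf_ball (uniform_count_measure V) \<longleftrightarrow> (\<forall>x\<in>V. \<bar>v x\<bar> \<le> 1)"
  using assms by (simp add: Linf_ball_iff AE_uniform_count_measure)

lemma joint_map_measurable:
  assumes "\<And>i. i < k \<Longrightarrow> f i \<in> borel_measurable M" "\<And>i. i < k \<Longrightarrow> A (f i) \<in> borel_measurable M"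
  shows "(\<lambda>x. \<lambda>i\<in>{..<2 * k}. if i < k then f i x else A (f (i - k)) x) \<in> M \<rightarrow>\<^sub>M Rn (2 * k)"
  unfolding Rn_def
proof (rule measurable_restrict)
  fix i assume "i \<in> {..<2 * k}"
  then show "(\<lambda>x. if i < k then f i x else A (f (i - k)) x) \<in> borel_measurable M"
    using assms(1)[of i] assms(2)[of "i - k"] by (cases "i < k") auto
qed

text \<open>The Euclidean norm is at most the sum of absolute values, and only the first
  \<open>k\<close> coordinates contribute: the images under the two operators will agree exactly at
  matched points.\<close>

lemma Rn_dist_joint_le:
  fixes a b a' b' :: "nat \<Rightarrow> real"
  assumes "\<And>i. i < k \<Longrightarrow> \<bar>a i - b i\<bar> \<le> e" "\<And>i. i < k \<Longrightarrow> a' i = b' i"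
  shows "Rn_dist (2 * k) (\<lambda>i\<in>{..<2 * k}. if i < k then a i else a' (i - k))
      (\<lambda>i\<in>{..<2 * k}. if i < k then b i else b' (i - k)) \<le> real k * e" (is "Rn_dist _ ?x ?y \<le> _")
proof -
  have "Rn_dist (2 * k) ?x ?y \<le> (\<Sum>i<2 * k. \<bar>?x i - ?y i\<bar>)"
    unfolding Rn_dist_def by (rule L2_set_le_sum_abs)
  also have "\<dots> \<le> (\<Sum>i<2 * k. if i < k then e else 0)"
    using assms by (intro sum_mono) auto
  also have "\<dots> = (\<Sum>i\<in>{..<2 * k} \<inter> {i. i < k}. e)" by (simp add: sum.If_cases)
  also have "{..<2 * k} \<inter> {i. i < k} = {..<k}" by auto
  also have "(\<Sum>i<k. e) = real k * e" by simp
  finally show ?thesis .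
qed

lemma k_profile_prob_space:
  assumes "prob_space M" "\<And>f. f \<in> Linf_ball M \<Longrightarrow> A f \<in> borel_measurable M" "\<mu> \<in> k_profile M A k"
  shows "prob_space \<mu>"
proof -
  from assms(3) obtain f where f: "\<forall>i<k. f i \<in> Linf_ball M" and \<mu>: "\<mu> = joint_distr M A k f"
    by (auto simp: k_profile_def)
  show ?thesis
    unfolding \<mu> joint_distr_def
    by (intro prob_space.prob_space_distr[OF assms(1)] joint_map_measurable assms(2))
       (use f in \<open>auto simp: Linf_ball_iff\<close>)
qed

lemma k_profile_nonempty: "k_profile M A k \<noteq> {}"
proof -
  have "joint_distr M A k (\<lambda>_ _. 0) \<in> k_profile M A k"
    unfolding k_profile_def by (auto simp: Linf_ball_iff intro!: exI[of _ "\<lambda>_ _. 0"])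
  then show ?thesis by blast
qed

section \<open>Comparison of the profiles of a star and of the limit operator\<close>

locale lebesgue_ultrafilter = positive_ultrafilter lebesgue01 U for U
begin

text \<open>Images are constant on \<open>[0,1)\<close>, hence integrable, and the operator norm is
  at most 1 because the integral of a function in the unit ball is.\<close>

lemma P_operator_delta_operator: "P_operator lebesgue01 (delta_operator U)"
proof -
  have int: "integrable lebesgue01 (delta_operator U f)" for f
  proof (rule integrable_const_bound)
    show "AE x in lebesgue01. norm (delta_operator U f x) \<le> \<bar>delta_integral lebesgue01 U f\<bar>"
      by (auto simp: delta_operator_def indicator_def)
  qed measurable
  have "norm_inf_1 lebesgue01 (delta_operator U) \<le> 1"
    unfolding norm_inf_1_def
  proof (rule SUP_least)
    fix f assume "f \<in> Linf_ball lebesgue01"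
    then have b: "\<bar>delta_integral lebesgue01 U f\<bar> \<le> 1" by (rule abs_delta_integral_le_1)
    have "(\<integral>\<^sup>+x. ennreal \<bar>delta_operator U f x\<bar> \<partial>lebesgue01) \<le> (\<integral>\<^sup>+x. ennreal 1 \<partial>lebesgue01)"
      using b by (intro nn_integral_mono ennreal_leI) (auto simp: delta_operator_def indicator_def)
    then show "(\<integral>\<^sup>+x. ennreal \<bar>delta_operator U f x\<bar> \<partial>lebesgue01) \<le> 1"
      using emeasure_space_1 by simp
  qed
  then have norm: "norm_inf_1 lebesgue01 (delta_operator U) < \<infinity>"
    by (rule order_le_less_trans) simp
  show ?thesis
    unfolding P_operator_def
  proof (intro conjI ballI allI impI)
    fix f g assume fg: "f \<in> Linf lebesgue01" "g \<in> Linf lebesgue01"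
    show "AE x in lebesgue01. delta_operator U f x = delta_operator U g x"
      if "AE x in lebesgue01. f x = g x"
      using delta_integral_cong_AE[OF fg that] by (simp add: delta_operator_def)
    show "AE x in lebesgue01. delta_operator U (\<lambda>y. a * f y + b * g y) x
        = a * delta_operator U f x + b * delta_operator U g x" for a b
      using delta_integral_linear[OF fg, of a b] by (simp add: delta_operator_def algebra_simps)
  qed (use int norm prob_space_axioms in blast)+
qed

text \<open>The intervals are matched with the vertices, the one in \<open>U\<close> with the
  center. All other matched points have identical joint values, so the error is the mass
  \<open>1/n\<close> of a single interval.\<close>

lemma profile_star_near_delta:
  fixes V :: "'v set"
  assumes V: "finite V" "c \<in> V" and nb: "\<forall>x\<in>V - {c}. {y \<in> V. adj x y} = {c}"
    and e: "0 < e" "1 / real (card V) \<le> e"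
    and v: "\<forall>i<k. v i \<in> Linf_ball (uniform_count_measure V)"
  shows "\<exists>f. (\<forall>i<k. f i \<in> Linf_ball lebesgue01) \<and>
    LP_dist (2 * k) (joint_distr (uniform_count_measure V) (adjacency_operator V adj) k v)
       (joint_distr lebesgue01 (delta_operator U) k f) \<le> e"
proof -
  define n where "n = card V"
  have n: "0 < n" using V by (auto simp: n_def card_gt_0_iff)
  have v1: "\<bar>v i y\<bar> \<le> 1" if "i < k" "y \<in> V" for i y
    using v that V by (simp add: Linf_ball_uniform_count_measure)
  define I where "I j = {real j / real n..<(real j + 1) / real n}" for j
  have floor: "nat \<lfloor>real n * x\<rfloor> = j" if "x \<in> I j" for x j
  proof -
    have "real j \<le> real n * x" "real n * x < real j + 1"
      using that n by (auto simp: I_def field_simps)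
    then have "\<lfloor>real n * x\<rfloor> = int j" by linarith
    then show ?thesis by simp
  qed
  have I01: "I j \<subseteq> {0..<1}" if "j < n" for j
  proof -
    have "(real j + 1) / real n \<le> 1" "0 \<le> real j / real n" using that by (auto simp: field_simps)
    then show ?thesis unfolding I_def by auto
  qed
  have cover: "{0..<1} \<subseteq> (\<Union>j\<in>{..<n}. I j)"
  proof
    fix x :: real assume x: "x \<in> {0..<1}"
    define j where "j = nat \<lfloor>real n * x\<rfloor>"
    have "0 \<le> real n * x" "real n * x < real n" using x n by auto
    then have "real j \<le> real n * x" "real n * x < real j + 1" "j < n"
      unfolding j_def by linarith+
    then show "x \<in> (\<Union>j\<in>{..<n}. I j)" using n by (auto simp: I_def field_simps)
  qed
  have Isets: "I j \<in> sets lebesgue01" if "j < n" for j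
    using I01[OF that] by (auto simp: sets_restrict_space_iff I_def)
  have Imeas: "measure lebesgue01 (I j) = 1 / real n" if "j < n" for j
  proof -
    have "measure lebesgue01 (I j) = measure lborel (I j)"
      using I01[OF that] by (intro measure_restrict_space) auto
    also have "\<dots> = 1 / real n"
      unfolding I_def using n by (subst measure_lborel_Ico) (auto simp: field_simps)
    finally show ?thesis .
  qed
  obtain j0 where j0: "j0 < n" "I j0 \<in> U"
    using finite_UN_in_U[of "{..<n}" I] Isets cover by (auto simp: space_lebesgue01)
  obtain h where h: "bij_betw h ({..<n} - {j0}) (V - {c})"
    using finite_same_card_bij[of "{..<n} - {j0}" "V - {c}"] V j0 by (auto simp: n_def)
  have hV: "h j \<in> V - {c}" if "j < n" "j \<noteq> j0" for j
    using h that by (auto simp: bij_betw_def)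
  define w where "w j = (if j = j0 then c else h j)" for j
  have wV: "w j \<in> V" if "j < n" for j using hV[OF that] V by (auto simp: w_def)
  \<comment> \<open>The floor recovers the index of the interval containing \<open>x\<close>, and
    this closed form makes \<open>f i\<close> measurable on the whole line.\<close>
  define f where "f i x = v i (w (nat \<lfloor>real n * x\<rfloor>))" for i and x :: real
  have fI: "f i x = v i (w j)" if "x \<in> I j" for i x j
    using floor[OF that] by (simp add: f_def)
  have fm: "f i \<in> borel_measurable lebesgue01" for i
  proof -
    have "(\<lambda>x. v i (w (nat \<lfloor>real n * x\<rfloor>))) \<in> borel_measurable borel" by measurable
    then show ?thesis unfolding f_def[abs_def] by (intro measurable_restrict_space1) simp
  qed
  have ball: "f i \<in> Linf_ball lebesgue01" if "i < k" for i
    unfolding Linf_ball_iff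
  proof (intro conjI fm AE_I2)
    fix x assume "x \<in> space lebesgue01"
    then obtain j where "j < n" "x \<in> I j" using cover by (auto simp: space_lebesgue01)
    then show "\<bar>f i x\<bar> \<le> 1" using fI v1[OF that] wV by simp
  qed
  have L: "delta_integral lebesgue01 U (f i) = v i c" if "i < k" for i
  proof (rule delta_integral_eq)
    show "f i \<in> Linf lebesgue01" using ball[OF that] by (simp add: Linf_ball_def)
    show "ulim (f i) (v i c)"
      unfolding ulim_def
    proof (intro allI impI)
      fix d :: real assume "0 < d"
      show "{x \<in> space lebesgue01. \<bar>f i x - v i c\<bar> \<le> d} \<in> U"
      proof (rule superset_U[OF j0(2)])
        note [measurable] = fm
        show "{x \<in> space lebesgue01. \<bar>f i x - v i c\<bar> \<le> d} \<in> sets lebesgue01" by measurable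
        show "I j0 \<subseteq> {x \<in> space lebesgue01. \<bar>f i x - v i c\<bar> \<le> d}"
          using I01[OF j0(1)] fI[of _ j0] \<open>0 < d\<close> by (auto simp: space_lebesgue01 w_def)
      qed
    qed
  qed
  \<comment> \<open>At the center the adjacency operator sums values at the neighbors, which need
    not resemble the limit. The center is therefore in no cell, and \<open>I j0\<close>, with empty
    partner, is charged its full mass through \<open>\<eta>\<close>.\<close>
  define C where "C j = (if j = j0 then {} else {h j})" for j
  let ?N = "uniform_count_measure V"
  have "LP_dist (2 * k) (joint_distr lebesgue01 (delta_operator U) k f)
      (joint_distr ?N (adjacency_operator V adj) k v) \<le> e"
    unfolding joint_distr_def
  proof (rule LP_dist_distr_le[where J = "{..<n}" and A = I and C = C
        and \<eta> = "\<lambda>j. if j = j0 then 1 / real n else 0"])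
    show "prob_space lebesgue01" by (rule prob_space_axioms)
    show "prob_space ?N" using V by (intro prob_space_uniform_count_measure) auto
    show "(\<lambda>x. \<lambda>i\<in>{..<2 * k}. if i < k then f i x else delta_operator U (f (i - k)) x)
        \<in> lebesgue01 \<rightarrow>\<^sub>M Rn (2 * k)"
      by (intro joint_map_measurable fm delta_operator_measurable)
    show "(\<lambda>x. \<lambda>i\<in>{..<2 * k}. if i < k then v i x else adjacency_operator V adj (v (i - k)) x)
        \<in> ?N \<rightarrow>\<^sub>M Rn (2 * k)"
      by (intro joint_map_measurable) auto
    show "I j \<in> sets lebesgue01" if "j \<in> {..<n}" for j using that Isets by simp
    show "disjoint_family_on I {..<n}"
      unfolding disjoint_family_on_def using floor by blast
    show "AE x in lebesgue01. x \<in> (\<Union>j\<in>{..<n}. I j)"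
      using cover by (intro AE_I2) (auto simp: space_lebesgue01)
    show "C j \<in> sets ?N" if "j \<in> {..<n}" for j
      using that hV[of j] by (auto simp: C_def sets_uniform_count_measure)
    show "disjoint_family_on C {..<n}"
      using h by (auto simp: disjoint_family_on_def C_def bij_betw_def inj_on_def)
    show "measure lebesgue01 (I j) \<le> measure ?N (C j) + (if j = j0 then 1 / real n else 0)"
      if "j \<in> {..<n}" for j
      using that Imeas[of j] hV[of j] V by (auto simp: C_def measure_uniform_count_measure n_def)
    show "sum (\<lambda>j. if j = j0 then 1 / real n else 0) {..<n} \<le> e"
      using j0 e(2) by (simp add: n_def)
    fix j x y assume *: "j \<in> {..<n}" "x \<in> I j" "y \<in> C j"
    then have y: "y = h j" "j \<noteq> j0" by (auto simp: C_def split: if_splits)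
    have yV: "y \<in> V - {c}" using hV[of j] * y by simp
    have fv: "f i x = v i y" for i using fI[OF *(2)] y by (simp add: w_def)
    have "x \<in> {0..<1}" using I01[of j] * by blast
    then have "delta_operator U (f i) x = adjacency_operator V adj (v i) y" if "i < k" for i
      using L[OF that] bspec[OF nb yV] by (simp add: delta_operator_def adjacency_operator_def)
    with fv have "Rn_dist (2 * k)
        (\<lambda>i\<in>{..<2 * k}. if i < k then f i x else delta_operator U (f (i - k)) x)
        (\<lambda>i\<in>{..<2 * k}. if i < k then v i y else adjacency_operator V adj (v (i - k)) y) \<le> real k * 0"
      by (intro Rn_dist_joint_le) auto
    then show "Rn_dist (2 * k)
        (\<lambda>i\<in>{..<2 * k}. if i < k then f i x else delta_operator U (f (i - k)) x)
        (\<lambda>i\<in>{..<2 * k}. if i < k then v i y else adjacency_operator V adj (v (i - k)) y) < e"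
      using e by simp
  qed (use e in auto)
  then have "LP_dist (2 * k) (joint_distr ?N (adjacency_operator V adj) k v)
      (joint_distr lebesgue01 (delta_operator U) k f) \<le> e"
    by (rule ord_eq_le_trans[OF LP_dist_commute])
  with ball show ?thesis by (intro exI[of _ f] conjI allI impI)
qed

text \<open>Here \<open>real k / real m\<close> bounds the displacement inside a grid box and
  \<open>2 * real (card J) / real (card V)\<close> the mass lost by rounding box proportions to
  whole numbers of leaves. Both are the same for all tuples \<open>f\<close>, as \<open>J\<close>
  depends only on \<open>k\<close> and \<open>m\<close>.\<close>

lemma profile_delta_near_star:
  fixes V :: "'v set" and m k :: nat
  defines "J \<equiv> {..<k} \<rightarrow>\<^sub>E {- int m..int m}"
  assumes V: "finite V" "c \<in> V" and nb: "\<forall>x\<in>V - {c}. {y \<in> V. adj x y} = {c}"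
    and m: "0 < m" and e: "real k / real m < e" "2 * real (card J) / real (card V) \<le> e"
    and f: "\<forall>i<k. f i \<in> Linf_ball lebesgue01"
  shows "\<exists>v. (\<forall>i<k. v i \<in> Linf_ball (uniform_count_measure V)) \<and>
    LP_dist (2 * k) (joint_distr (uniform_count_measure V) (adjacency_operator V adj) k v)
       (joint_distr lebesgue01 (delta_operator U) k f) \<le> e"
proof -
  let ?M = lebesgue01 and ?N = "uniform_count_measure V"
  define n where "n = card V"
  have n: "0 < n" using V by (auto simp: n_def card_gt_0_iff)
  have e0: "0 < e" using e(1) by (rule le_less_trans[rotated]) simp
  have J: "finite J" unfolding J_def by (intro finite_PiE) auto
  have fm: "f i \<in> borel_measurable ?M" and f1: "AE x in ?M. \<bar>f i x\<bar> \<le> 1" if "i < k" for i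
    using f that by (auto simp: Linf_ball_iff)
  \<comment> \<open>Requiring the bound 1 pointwise discards only a null set and guarantees that
    values sampled from a cell stay in the unit ball.\<close>
  define A where "A j = {x \<in> space ?M. \<forall>i\<in>{..<k}. \<bar>f i x\<bar> \<le> 1 \<and> \<lfloor>real m * f i x\<rfloor> = j i}"
    for j :: "nat \<Rightarrow> int"
  have Asets: "A j \<in> sets ?M" for j
    unfolding A_def
  proof (rule sets.sets_Collect_finite_All)
    fix i assume "i \<in> {..<k}"
    then have [measurable]: "f i \<in> borel_measurable ?M" using fm by simp
    show "{x \<in> space ?M. \<bar>f i x\<bar> \<le> 1 \<and> \<lfloor>real m * f i x\<rfloor> = j i} \<in> sets ?M" by measurable
  qed simp
  have disjA: "disjoint_family_on A J"
    unfolding disjoint_family_on_def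
  proof (intro ballI impI equals0I)
    fix j j' x assume "j \<in> J" "j' \<in> J" "j \<noteq> j'" and x: "x \<in> A j \<inter> A j'"
    then have "j i = j' i" if "i < k" for i using that by (auto simp: A_def)
    with \<open>j \<in> J\<close> \<open>j' \<in> J\<close> have "j = j'" unfolding J_def by (intro PiE_ext) auto
    with \<open>j \<noteq> j'\<close> show False by blast
  qed
  have cover: "AE x in ?M. x \<in> (\<Union>j\<in>J. A j)"
  proof -
    have "AE x in ?M. \<forall>i\<in>{..<k}. \<bar>f i x\<bar> \<le> 1"
      by (intro AE_finite_allI) (auto intro: f1)
    with AE_space show ?thesis
    proof eventually_elim
      case (elim x)
      define j where "j = (\<lambda>i\<in>{..<k}. \<lfloor>real m * f i x\<rfloor>)"
      have "- int m \<le> \<lfloor>real m * f i x\<rfloor> \<and> \<lfloor>real m * f i x\<rfloor> \<le> int m" if "i < k" for i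
      proof -
        have "\<bar>real m * f i x\<bar> \<le> real m"
          using elim that mult_left_mono[of "\<bar>f i x\<bar>" 1 "real m"] by (simp add: abs_mult)
        then show ?thesis by linarith
      qed
      then have "j \<in> J" by (auto simp: j_def J_def)
      moreover have "x \<in> A j" using elim by (auto simp: A_def j_def)
      ultimately show ?case by blast
    qed
  qed
  define p where "p j = measure ?M (A j)" for j
  have p: "0 \<le> p j" "p j \<le> 1" for j by (auto simp: p_def)
  have "(\<Sum>j\<in>J. p j) = measure ?M (\<Union>j\<in>J. A j)"
    unfolding p_def using J Asets disjA by (intro finite_measure_finite_Union[symmetric]) auto
  then have sum_p: "(\<Sum>j\<in>J. p j) \<le> 1" by simp
  \<comment> \<open>Only \<open>n - 1\<close> leaves are available; rounding down makes the total
    fit.\<close>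
  define a where "a j = nat \<lfloor>real (n - 1) * p j\<rfloor>" for j
  have a: "real (a j) \<le> real (n - 1) * p j" "real (n - 1) * p j < real (a j) + 1" for j
  proof -
    have "0 \<le> real (n - 1) * p j" using p by simp
    then show "real (a j) \<le> real (n - 1) * p j" "real (n - 1) * p j < real (a j) + 1"
      unfolding a_def by linarith+
  qed
  have "real (\<Sum>j\<in>J. a j) \<le> (\<Sum>j\<in>J. real (n - 1) * p j)" using a by (simp add: sum_mono)
  also have "\<dots> = real (n - 1) * (\<Sum>j\<in>J. p j)" by (simp add: sum_distrib_left)
  also have "\<dots> \<le> real (n - 1)" using sum_p by (intro mult_left_le) auto
  finally have "(\<Sum>j\<in>J. a j) \<le> n - 1" by (simp only: of_nat_le_iff)
  then have "(\<Sum>j\<in>J. a j) \<le> card (V - {c})" using V by (simp add: n_def)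
  from J finite_Diff[OF V(1)] this
  obtain C where C: "\<And>j. j \<in> J \<Longrightarrow> C j \<subseteq> V - {c}" "\<And>j. j \<in> J \<Longrightarrow> card (C j) = a j"
    and disjC: "disjoint_family_on C J"
    by (rule disjoint_family_of_cards) (rule that)
  define P where "P y x \<longleftrightarrow> (\<exists>j\<in>J. y \<in> C j \<and> x \<in> A j)" for y x
  \<comment> \<open>One sample point serves all indices \<open>i\<close>, so the whole
    \<open>k\<close>-tuple at a leaf comes from the same cell.\<close>
  define r where "r y = (SOME x. P y x)" for y
  \<comment> \<open>The value at \<open>c\<close> makes the adjacency operator return the limit
    along \<open>U\<close> at every leaf. Leaves left over by the rounding get the default 0, which
    stays in the unit ball.\<close>
  define v where "v i y = (if y = c then delta_integral ?M U (f i) else if \<exists>x. P y x then f i (r y) else 0)"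
    for i y
  have r: "r y \<in> A j" "v i y = f i (r y)" if j: "j \<in> J" "y \<in> C j" "x \<in> A j" for i j x y
  proof -
    have ex: "\<exists>x. P y x" using j by (auto simp: P_def)
    then have "P y (r y)" unfolding r_def by (rule someI_ex)
    then obtain j' where j': "j' \<in> J" "y \<in> C j'" "r y \<in> A j'" by (auto simp: P_def)
    have "j' = j" using disjC j j' by (auto simp: disjoint_family_on_def)
    with j' show "r y \<in> A j" by simp
    show "v i y = f i (r y)" using ex C(1)[OF j(1)] j by (auto simp: v_def)
  qed
  have v1: "\<bar>v i y\<bar> \<le> 1" if "i < k" for i y
  proof -
    have "\<bar>f i (r y)\<bar> \<le> 1" if "\<exists>x. P y x"
    proof -
      from that have "P y (r y)" unfolding r_def by (rule someI_ex)
      then show ?thesis using \<open>i < k\<close> by (auto simp: P_def A_def)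
    qed
    then show ?thesis using abs_delta_integral_le_1[of "f i"] f that by (simp add: v_def)
  qed
  have "LP_dist (2 * k) (joint_distr ?M (delta_operator U) k f)
      (joint_distr ?N (adjacency_operator V adj) k v) \<le> e"
    unfolding joint_distr_def
  proof (rule LP_dist_distr_le[where J = J and A = A and C = C and \<eta> = "\<lambda>j. 2 / real n"])
    show "prob_space ?M" by (rule prob_space_axioms)
    show "prob_space ?N" using V by (intro prob_space_uniform_count_measure) auto
    show "(\<lambda>x. \<lambda>i\<in>{..<2 * k}. if i < k then f i x else delta_operator U (f (i - k)) x)
        \<in> ?M \<rightarrow>\<^sub>M Rn (2 * k)"
      by (intro joint_map_measurable fm delta_operator_measurable)
    show "(\<lambda>x. \<lambda>i\<in>{..<2 * k}. if i < k then v i x else adjacency_operator V adj (v (i - k)) x)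
        \<in> ?N \<rightarrow>\<^sub>M Rn (2 * k)"
      by (intro joint_map_measurable) auto
    show "C j \<in> sets ?N" if "j \<in> J" for j
      using C(1)[OF that] by (auto simp: sets_uniform_count_measure)
    \<comment> \<open>The 2 has two sources: rounding down loses less than 1, and replacing
      \<open>n\<close> by \<open>n - 1\<close> loses \<open>p j\<close>, which is at most 1.\<close>
    show "measure ?M (A j) \<le> measure ?N (C j) + 2 / real n" if "j \<in> J" for j
    proof -
      have "real n * p j = real (n - 1) * p j + p j" using n by (simp add: of_nat_diff algebra_simps)
      then have "real n * p j \<le> real (a j) + 2" using a(2)[of j] p(2)[of j] by linarith
      then have "p j \<le> real (a j) / real n + 2 / real n" using n by (simp add: field_simps)
      moreover have "measure ?N (C j) = real (a j) / real n"
        using C[OF that] V by (subst measure_uniform_count_measure) (auto simp: n_def)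
      ultimately show ?thesis by (simp add: p_def)
    qed
    show "(\<Sum>j\<in>J. 2 / real n) \<le> e" using e(2) by (simp add: n_def mult.commute)
    fix j x y assume *: "j \<in> J" "x \<in> A j" "y \<in> C j"
    have yV: "y \<in> V - {c}" using C(1) * by blast
    have x: "x \<in> {0..<1}" using *(2) by (auto simp: A_def space_lebesgue01)
    have ry: "r y \<in> A j" and vy: "\<And>i. v i y = f i (r y)" using r *(1,3,2) by blast+
    have near: "\<bar>f i x - v i y\<bar> \<le> 1 / real m" if "i < k" for i
    proof -
      have "\<lfloor>real m * f i x\<rfloor> = \<lfloor>real m * f i (r y)\<rfloor>"
        using ry *(2) that by (auto simp: A_def)
      then have "\<bar>real m * f i x - real m * f i (r y)\<bar> \<le> 1" by linarith
      then have "real m * \<bar>f i x - v i y\<bar> \<le> 1" by (simp add: vy abs_mult flip: right_diff_distrib)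
      then show ?thesis using m by (simp add: field_simps)
    qed
    have "delta_operator U (f i) x = adjacency_operator V adj (v i) y" for i
      using x bspec[OF nb yV] by (simp add: delta_operator_def adjacency_operator_def v_def)
    with near have "Rn_dist (2 * k)
        (\<lambda>i\<in>{..<2 * k}. if i < k then f i x else delta_operator U (f (i - k)) x)
        (\<lambda>i\<in>{..<2 * k}. if i < k then v i y else adjacency_operator V adj (v (i - k)) y)
      \<le> real k * (1 / real m)"
      by (intro Rn_dist_joint_le) auto
    then show "Rn_dist (2 * k)
        (\<lambda>i\<in>{..<2 * k}. if i < k then f i x else delta_operator U (f (i - k)) x)
        (\<lambda>i\<in>{..<2 * k}. if i < k then v i y else adjacency_operator V adj (v (i - k)) y) < e"
      using e(1) by simp
  qed (use J Asets disjA cover disjC e0 in auto)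
  then have LP: "LP_dist (2 * k) (joint_distr ?N (adjacency_operator V adj) k v)
      (joint_distr ?M (delta_operator U) k f) \<le> e"
    by (rule ord_eq_le_trans[OF LP_dist_commute])
  have "\<forall>i<k. v i \<in> Linf_ball ?N"
    using v1 V by (simp add: Linf_ball_uniform_count_measure)
  then show ?thesis using LP by (intro exI[of _ v] conjI)
qed

text \<open>The bound 1, uniform in \<open>k\<close> and in the graph, is what dominates the series
  defining \<open>d_M\<close>.\<close>

lemma hausdorff_star_delta_bounds:
  fixes V :: "'v set"
  assumes "finite V" "V \<noteq> {}"
  shows "0 \<le> hausdorff_distance (LP_dist d) (k_profile (uniform_count_measure V) A k)
      (k_profile lebesgue01 (delta_operator U) k)"
    and "hausdorff_distance (LP_dist d) (k_profile (uniform_count_measure V) A k)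
      (k_profile lebesgue01 (delta_operator U) k) \<le> 1"
proof -
  let ?X = "k_profile (uniform_count_measure V) A k"
  let ?Y = "k_profile lebesgue01 (delta_operator U) k"
  have X: "prob_space \<mu>" if "\<mu> \<in> ?X" for \<mu>
    using that
    by (rule k_profile_prob_space[rotated 2]) (use assms prob_space_uniform_count_measure in auto)
  have Y: "prob_space \<mu>" if "\<mu> \<in> ?Y" for \<mu>
    using that prob_space_axioms delta_operator_measurable by (rule k_profile_prob_space[rotated 2])
  note bounds = LP_dist_bounds[OF X Y, of _ _ d]
  show "0 \<le> hausdorff_distance (LP_dist d) ?X ?Y"
    by (rule hausdorff_distance_nonneg[OF k_profile_nonempty k_profile_nonempty bounds])
  show "hausdorff_distance (LP_dist d) ?X ?Y \<le> 1"
  proof (rule hausdorff_distance_le[OF k_profile_nonempty k_profile_nonempty bounds(1)])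
    show "\<exists>\<nu>\<in>?Y. LP_dist d \<mu> \<nu> \<le> 1" if "\<mu> \<in> ?X" for \<mu>
      using bounds(2)[OF that] k_profile_nonempty[of lebesgue01 "delta_operator U" k] by blast
    show "\<exists>\<mu>\<in>?X. LP_dist d \<mu> \<nu> \<le> 1" if "\<nu> \<in> ?Y" for \<nu>
      using bounds(2)[OF _ that] k_profile_nonempty[of "uniform_count_measure V" A k] by blast
  qed
qed

lemma hausdorff_star_delta_le:
  fixes V :: "'v set" and m k :: nat
  assumes star: "star_graph n V adj" "3 \<le> n" and m: "0 < m"
    and e: "real k / real m < e" "1 / real n \<le> e"
      "2 * real (card ({..<k} \<rightarrow>\<^sub>E {- int m..int m})) / real n \<le> e"
  shows "hausdorff_distance (LP_dist (2 * k))
      (k_profile (uniform_count_measure V) (adjacency_operator V adj) k)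
      (k_profile lebesgue01 (delta_operator U) k) \<le> e"
proof -
  let ?N = "uniform_count_measure V" and ?S = "adjacency_operator V adj"
  let ?X = "k_profile ?N ?S k"
  let ?Y = "k_profile lebesgue01 (delta_operator U) k"
  have n: "card V = n" using star by (simp add: star_graph_def)
  have e0: "0 < e" using e(1) by (rule le_less_trans[rotated]) simp
  obtain c where V: "finite V" "c \<in> V" and nb: "\<forall>x\<in>V - {c}. {y \<in> V. adj x y} = {c}"
    using star_graph_center[OF star] by metis
  have prob: "prob_space ?N" using V by (intro prob_space_uniform_count_measure) auto
  show ?thesis
  proof (rule hausdorff_distance_le[OF k_profile_nonempty k_profile_nonempty])
    fix \<mu> \<nu> assume "\<mu> \<in> ?X" "\<nu> \<in> ?Y"
    then have "prob_space \<mu>" "prob_space \<nu>"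
      using k_profile_prob_space[OF prob, of ?S] k_profile_prob_space[OF prob_space_axioms, of "delta_operator U"]
      by (auto intro: delta_operator_measurable)
    then show "0 \<le> LP_dist (2 * k) \<mu> \<nu>" by (rule LP_dist_bounds)
  next
    fix \<mu> assume "\<mu> \<in> ?X"
    then obtain v where v: "\<forall>i<k. v i \<in> Linf_ball ?N" and \<mu>: "\<mu> = joint_distr ?N ?S k v"
      by (auto simp: k_profile_def)
    from profile_star_near_delta[OF V nb e0 e(2)[folded n] v] obtain f
      where f: "\<forall>i<k. f i \<in> Linf_ball lebesgue01"
        "LP_dist (2 * k) \<mu> (joint_distr lebesgue01 (delta_operator U) k f) \<le> e"
      unfolding \<mu> by (elim exE conjE)
    from f(1) have "joint_distr lebesgue01 (delta_operator U) k f \<in> ?Y"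
      unfolding k_profile_def by blast
    with f(2) show "\<exists>\<nu>\<in>?Y. LP_dist (2 * k) \<mu> \<nu> \<le> e" by (rule bexI)
  next
    fix \<nu> assume "\<nu> \<in> ?Y"
    then obtain f where f: "\<forall>i<k. f i \<in> Linf_ball lebesgue01"
      and \<nu>: "\<nu> = joint_distr lebesgue01 (delta_operator U) k f"
      by (auto simp: k_profile_def)
    from profile_delta_near_star[OF V nb m e(1) e(3)[folded n] f] obtain v
      where v: "\<forall>i<k. v i \<in> Linf_ball ?N" "LP_dist (2 * k) (joint_distr ?N ?S k v) \<nu> \<le> e"
      unfolding \<nu> by (elim exE conjE)
    from v(1) have "joint_distr ?N ?S k v \<in> ?X" unfolding k_profile_def by blast
    with v(2) show "\<exists>\<mu>\<in>?X. LP_dist (2 * k) \<mu> \<nu> \<le> e" by (rule bexI)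
  qed
qed

section \<open>Passage to the limit, first for each \<open>k\<close> and then for the sum\<close>

lemma hausdorff_star_delta_tendsto:
  fixes V :: "nat \<Rightarrow> 'v set" and k :: nat
  assumes star: "\<forall>n\<ge>3. star_graph n (V n) (adj n)"
  shows "(\<lambda>n. hausdorff_distance (LP_dist (2 * k))
      (k_profile (uniform_count_measure (V n)) (adjacency_operator (V n) (adj n)) k)
      (k_profile lebesgue01 (delta_operator U) k)) \<longlonglongrightarrow> 0" (is "?h \<longlonglongrightarrow> 0")
proof (rule tendstoI)
  fix d :: real assume "0 < d"
  \<comment> \<open>The estimates give a weak inequality with \<open>e\<close>, while the limit
    requires a strict one with \<open>d\<close>.\<close>
  define e where "e = d / 2"
  have e: "0 < e" "e < d" using \<open>0 < d\<close> by (simp_all add: e_def)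
  \<comment> \<open>The mesh is fixed first, from \<open>k\<close> and \<open>e\<close> alone; the
    number of grid cells is then a constant, and dividing it by \<open>n\<close> gives a null
    sequence.\<close>
  obtain m :: nat where "real k / e < real m" using reals_Archimedean2 by blast
  moreover have "0 \<le> real k / e" using e by simp
  ultimately have "0 < real m" "real k < e * real m" using e by (linarith, simp add: field_simps)
  then have m: "0 < m" "real k / real m < e" by (simp_all add: pos_divide_less_eq)
  have lim: "(\<lambda>n. a / real n) \<longlonglongrightarrow> 0" for a by (rule lim_const_over_n)
  have "eventually (\<lambda>n. 1 / real n < e) sequentially"
    "eventually (\<lambda>n. 2 * real (card ({..<k} \<rightarrow>\<^sub>E {- int m..int m})) / real n < e) sequentially"
    by (intro order_tendstoD(2)[OF lim] e)+
  then show "eventually (\<lambda>n. dist (?h n) 0 < d) sequentially"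
    using eventually_ge_at_top[of 3]
  proof eventually_elim
    case (elim n)
    with star have st: "star_graph n (V n) (adj n)" by blast
    have "finite (V n)" "V n \<noteq> {}"
      using st elim(3) by (auto simp: star_graph_def graph_tree_def graph_connected_def simple_graph_def)
    then have "0 \<le> ?h n" by (rule hausdorff_star_delta_bounds)
    moreover have "?h n \<le> e"
      using elim by (intro hausdorff_star_delta_le[OF st _ m]) auto
    ultimately show ?case using e by simp
  qed
qed

text \<open>Termwise convergence passes to the sum by Tannery's theorem, with the geometric series
  as majorant.\<close>

lemma d_M_star_delta_tendsto:
  fixes V :: "nat \<Rightarrow> 'v set"
  assumes star: "\<forall>n\<ge>3. star_graph n (V n) (adj n)"
  shows "(\<lambda>n. d_M (uniform_count_measure (V n)) (adjacency_operator (V n) (adj n))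
      lebesgue01 (delta_operator U)) \<longlonglongrightarrow> 0"
proof -
  define h where "h k n = hausdorff_distance (LP_dist (2 * Suc k))
      (k_profile (uniform_count_measure (V n)) (adjacency_operator (V n) (adj n)) (Suc k))
      (k_profile lebesgue01 (delta_operator U) (Suc k))" for k n
  have bd: "norm ((1 / 2) ^ Suc k * h k n) \<le> (1 / 2) ^ Suc k" if "3 \<le> n" for k n
  proof -
    have "star_graph n (V n) (adj n)" using star that by blast
    then have "finite (V n)" "V n \<noteq> {}"
      by (auto simp: star_graph_def graph_tree_def graph_connected_def simple_graph_def)
    then have "0 \<le> h k n" "h k n \<le> 1"
      unfolding h_def by (rule hausdorff_star_delta_bounds)+
    then show ?thesis by (simp add: abs_mult)
  qed
  have "(\<lambda>n. \<Sum>k. (1 / 2) ^ Suc k * h k n) \<longlonglongrightarrow> (\<Sum>k. 0)"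
  proof (rule tannerys_theorem[THEN conjunct2, THEN conjunct2])
    show "(\<lambda>n. (1 / 2) ^ Suc k * h k n) \<longlonglongrightarrow> 0" for k
      unfolding h_def by (intro tendsto_mult_right_zero hausdorff_star_delta_tendsto star)
    \<comment> \<open>The domination holds for all \<open>k\<close> at once as soon as
      \<open>n\<close> is at least 3, where the graphs are known to be stars.\<close>
    show "eventually (\<lambda>(k, n). norm ((1 / 2) ^ Suc k * h k n) \<le> (1 / 2) ^ Suc k)
        (at_top \<times>\<^sub>F sequentially)"
      unfolding eventually_prod_filter
      by (intro exI[of _ "\<lambda>_. True"] exI[of _ "\<lambda>n. 3 \<le> n"])
         (use bd eventually_ge_at_top[of 3] in simp)
    show "summable (\<lambda>k. (1 / 2 :: real) ^ Suc k)" by (simp add: summable_mult summable_geometric)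
  qed simp
  then show ?thesis by (simp add: d_M_def h_def)
qed

end

theorem theorem3p8:
  fixes U :: "real set set"
    and V :: "nat \<Rightarrow> 'v set"
    and adj :: "nat \<Rightarrow> 'v \<Rightarrow> 'v \<Rightarrow> bool"
  assumes "measure_ultrafilter lebesgue01 U"
    and "\<forall>n\<ge>3. star_graph n (V n) (adj n)"
  shows "P_operator lebesgue01 (delta_operator U) \<and>
    (\<lambda>n. d_M (uniform_count_measure (V n)) (adjacency_operator (V n) (adj n))
             lebesgue01 (delta_operator U)) \<longlonglongrightarrow> 0"
proof -
  interpret lebesgue_ultrafilter U
    using assms(1) prob_space_lebesgue01
    by (simp add: lebesgue_ultrafilter_def positive_ultrafilter_def positive_ultrafilter_axioms_def)
  show ?thesis
    using P_operator_delta_operator d_M_star_delta_tendsto[OF assms(2)] by blast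
qed

end
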